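(* If $\mu(t)\to\mu$ as $t\to\infty$ with $\mu\in(0,\infty)$, then $\mathbb{P}(D>t)\approx_{\log}\mathrm{e}^{-\gamma t}$ as $t\to\infty$, where $\gamma>0$ is the unique root of \[ 1=\int_0^\ell \mu\,\mathrm{e}^{(\gamma-\mu)s}\,\mathrm{d}s . \] Moreover, as $t\to\infty$, $-\log\mathbb{P}(D>t)/t$ converges to $0$ if $\mu(t)\to\infty$, and converges to $\infty$ if $\mu(t)\to 0$.
   Context: Let $\ell>0$ be fixed. $\mathcal N$ is an inhomogeneous Poisson point process on $(0,\infty)$ with rate function $\mu(t)$, i.e. with intensity measure $\mu(t)\,\mathrm{d}t$; write $M(a,b)=\int_a^b\mu(t)\,\mathrm{d}t$. It is assumed that $M(0,t)<\infty$ for every finite $t$ and that $\mu(t)>0$ for Lebesgue-almost all $t\ge 0$. Let $0<T_1<T_2<\cdots$ be the epochs (points) of $\mathcal N$, with $T_0=0$ by convention; if $\mathcal N$ has only finitely many points, say $n$ of them, then $T_{n+1}=\infty$. Define $D=\min\{T_n:\ n\ge 0,\ T_{n+1}-T_n\ge \ell\}$, with $D=\infty$ if there is no such $n$. The relation $f(t)\approx_{\log} g(t)$ means $\log f(t)/\log g(t)\to 1$ as $t\to\infty$. *)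

theory Defs
  imports "HOL-Probability.Probability"
begin

definition intensity :: "(real \<Rightarrow> real) \<Rightarrow> real measure" where
  "intensity \<mu> = density lborel (\<lambda>t. ennreal (\<mu> t) * indicator {0<..} t)"

definition cumulative_rate :: "(real \<Rightarrow> real) \<Rightarrow> real \<Rightarrow> real \<Rightarrow> ennreal" where
  "cumulative_rate \<mu> a b = (\<integral>\<^sup>+ t \<in> {a<..b}. ennreal (\<mu> t) \<partial>lborel)"

text \<open>The realisations are locally finite subsets of the open half-line, so every bounded set has a
  finite count. The Poisson law is written out, because \<^const>\<open>poisson_pmf\<close> is unspecified for
  rate 0, which does occur here (for instance for Lebesgue null sets).\<close>

definition poisson_point_process ::
    "'a measure \<Rightarrow> ('a \<Rightarrow> real set) \<Rightarrow> real measure \<Rightarrow> bool" where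
  "poisson_point_process P N \<Lambda> \<longleftrightarrow>
     prob_space P \<and>
     (\<forall>\<omega>\<in>space P. N \<omega> \<subseteq> {0<..} \<and> (\<forall>t. finite (N \<omega> \<inter> {..t}))) \<and>
     (\<forall>A\<in>sets borel. bounded A \<longrightarrow>
        (\<lambda>\<omega>. card (N \<omega> \<inter> A)) \<in> measurable P (count_space UNIV) \<and>
        (\<forall>k. measure P {\<omega>\<in>space P. card (N \<omega> \<inter> A) = k} =
             measure \<Lambda> A ^ k / fact k * exp (- measure \<Lambda> A))) \<and>
     (\<forall>(n::nat) A. (\<forall>i<n. A i \<in> sets borel \<and> bounded (A i)) \<longrightarrow>
        disjoint_family_on A {..<n} \<longrightarrow>
        prob_space.indep_vars P (\<lambda>_. count_space UNIV) (\<lambda>i \<omega>. card (N \<omega> \<inter> A i)) {..<n})"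

text \<open>The infimum below is a minimum when \<open>S\<close> is a locally finite set with points beyond
  \<open>epoch S n\<close>, and \<open>\<infinity>\<close> when there is no such point.\<close>

fun epoch :: "real set \<Rightarrow> nat \<Rightarrow> ereal" where
  "epoch S 0 = 0"
| "epoch S (Suc n) = Inf (ereal ` {x \<in> S. epoch S n < ereal x})"

text \<open>Only finite epochs are candidates, so the difference is never \<open>\<infinity> - \<infinity>\<close>. The epochs of a
  locally finite set have no finite accumulation point, so the infimum is a minimum unless
  there is no candidate, in which case it is \<open>\<infinity>\<close>.\<close>

definition first_gap :: "real \<Rightarrow> real set \<Rightarrow> ereal" where
  "first_gap l S = Inf {epoch S n | n. epoch S n < \<infinity> \<and> epoch S (Suc n) - epoch S n \<ge> ereal l}"

text \<open>The library sets \<^term>\<open>ln (0::real) = 0\<close>; here the logarithm of 0 is \<open>-\<infinity>\<close>.\<close>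

definition elog :: "real \<Rightarrow> ereal" where
  "elog x = (if x \<le> 0 then -\<infinity> else ereal (ln x))"

definition approx_log :: "(real \<Rightarrow> real) \<Rightarrow> (real \<Rightarrow> real) \<Rightarrow> bool" (infix "\<approx>log" 50) where
  "f \<approx>log g \<longleftrightarrow> ((\<lambda>t. elog (f t) / elog (g t)) \<longlongrightarrow> 1) at_top"

end

theory Submission
  imports Defs "HOL-Real_Asymp.Real_Asymp"
begin

text \<open>
  Cut the half-line into cells of width \<open>h = l / K\<close>. The event \<open>D > t\<close> says that every point of
  the process up to \<open>t\<close>, and the origin, is followed by another point at distance less than \<open>l\<close>.
  If it holds, no block of \<open>K\<close> consecutive cells starting before \<open>t\<close> is empty, because the last
  point before an empty block would see a gap of length \<open>l\<close>
  (\<open>covered_imp_blocks_hit\<close>). Conversely it holds as soon as no block of \<open>K - 1\<close> consecutive cells is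
  empty on a slightly longer stretch (\<open>blocks_hit_imp_covered\<close>). Cells are occupied independently, so
  \<open>\<P>(D > t)\<close> is caught between two probabilities that a sequence of independent trials has no long
  run of failures.

  Suppose first that every trial succeeds with probability \<open>p\<close>, and put \<open>q = 1 - p\<close>. The probability
  of having no run of \<open>K\<close> failures satisfies a linear recursion in the number of trials and the
  length of the current run. It decays geometrically with the ratio \<open>x\<close> for which
  \<open>1 = (\<Sum>i<K. p * q^i / x^(i+1))\<close>: this is the Lotka equation of the renewal process of successes
  killed at its first long gap. If the sum is at most (at least) 1, its
  truncations to \<open>K - r\<close> terms, as functions of the current run length \<open>r\<close>, form a supersolution
  (subsolution) of the recursion. As they decrease with \<open>r\<close>, this remains true when the success probabilities vary
  but stay below (above) \<open>p\<close>; this gives \<open>run_prob_le\<close> and \<open>run_prob_ge\<close> without any coupling.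

  With \<open>p = 1 - exp (- m * h)\<close> and \<open>x = exp (- \<gamma> * h)\<close> the sum is a Riemann sum of
  \<open>\<integral>\<^sub>0\<^sup>l m exp ((\<gamma> - m) s) ds\<close>, up to a factor \<open>exp (\<gamma> * h)\<close> (\<open>run_weight_bounds\<close>). Hence, for
  fine grids: if the rate is eventually at most \<open>m\<close> and this integral is below 1, then
  \<open>\<P>(D > t) \<le> C exp (- \<gamma> t)\<close>; if the rate is eventually at least \<open>m\<close> and the integral exceeds 1, then
  \<open>\<P>(D > t) \<ge> c exp (- \<gamma> t)\<close>. The initial stretch, where the rate is not yet controlled,
  costs only a constant factor: for the upper bound it is ignored, and for the lower bound
  all of its finitely many cells are required to be occupied, which has positive probability because
  the rate is positive almost everywhere.

  All three claims follow. The integral is strictly increasing in \<open>\<gamma>\<close>, so for a limit rate \<open>m\<close> every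
  exponent below (above) the root gives an upper (lower) bound, with room to perturb \<open>m\<close>. For any
  fixed \<open>\<gamma> > 0\<close> the integral exceeds 1 when \<open>m\<close> is large and tends to 0 with \<open>m\<close>; this
  settles the cases of rates tending to \<open>\<infinity>\<close> and to 0.
\<close>

section \<open>Gaps of a locally finite set\<close>

text \<open>The points form a chain that leads from the origin beyond \<open>t\<close> in steps shorter than \<open>l\<close>. The
  origin is included because it is the epoch of index 0.\<close>

definition covered :: "real \<Rightarrow> real set \<Rightarrow> real \<Rightarrow> bool" where
  "covered l S t \<longleftrightarrow> (\<forall>x\<in>insert 0 S. x \<le> t \<longrightarrow> (\<exists>y\<in>S. x < y \<and> y < x + l))"

lemma next_point:
  fixes S :: "real set"
  assumes fin: "\<And>t. finite (S \<inter> {..t})" and z: "z \<in> S" "x < z"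
  obtains y where "y \<in> S" "x < y" "\<And>z. z \<in> S \<Longrightarrow> x < z \<Longrightarrow> y \<le> z"
proof -
  define F where "F = S \<inter> {x<..z}"
  have F: "finite F" "F \<noteq> {}"
    using z by (auto simp: F_def intro: finite_subset[OF _ fin[of z]])
  show thesis
  proof (rule that[of "Min F"])
    show "Min F \<in> S" "x < Min F"
      using Min_in[OF F] by (auto simp: F_def)
    fix w assume w: "w \<in> S" "x < w"
    show "Min F \<le> w"
    proof (cases "w \<le> z")
      case True
      then show ?thesis
        using w F by (auto simp: F_def)
    next
      case False
      have "Min F \<le> z"
        using z F by (auto simp: F_def)
      with False show ?thesis
        by simp
    qed
  qed
qed

lemma last_point:
  fixes S :: "real set"
  assumes fin: "finite (S \<inter> {..t})" and t: "0 \<le> t"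
  obtains x where "x \<in> insert 0 S" "x \<le> t" "\<And>z. z \<in> S \<Longrightarrow> z \<le> t \<Longrightarrow> z \<le> x"
proof -
  define F where "F = insert 0 (S \<inter> {..t})"
  have F: "finite F" "F \<noteq> {}"
    using fin by (auto simp: F_def)
  show thesis
  proof (rule that[of "Max F"])
    show "Max F \<in> insert 0 S" "Max F \<le> t"
      using Max_in[OF F] t by (auto simp: F_def)
    show "z \<le> Max F" if "z \<in> S" "z \<le> t" for z
      using that F by (auto simp: F_def)
  qed
qed

lemma epoch_Suc_eq:
  assumes "epoch S n = ereal x" "y \<in> S" "x < y" "\<And>z. z \<in> S \<Longrightarrow> x < z \<Longrightarrow> y \<le> z"
  shows "epoch S (Suc n) = ereal y"
  using assms by (auto intro!: Inf_eqI)

lemma epoch_finite_in: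
  assumes fin: "\<And>t. finite (S \<inter> {..t})"
    and "epoch S n < \<infinity>"
  shows "\<exists>x\<in>insert 0 S. epoch S n = ereal x"
  using assms(2)
proof (induction n)
  case 0
  then show ?case by simp
next
  case (Suc n)
  then have "{x \<in> S. epoch S n < ereal x} \<noteq> {}"
    by (metis epoch.simps(2) image_empty Inf_empty top_ereal_def less_irrefl)
  then obtain z where z: "z \<in> S" "epoch S n < ereal z"
    by auto
  then have "epoch S n < \<infinity>"
    by auto
  with Suc obtain x where x: "epoch S n = ereal x"
    by blast
  with z have "x < z"
    by simp
  from next_point[OF fin z(1) this] epoch_Suc_eq[OF x] show ?case
    by (metis insertCI)
qed

text \<open>Induction along the points: the predecessor of \<open>x\<close>, which exists by local finiteness, is an
  epoch, and the next epoch is \<open>x\<close> itself.\<close>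

lemma epoch_surj:
  assumes pos: "S \<subseteq> {0<..}" and fin: "\<And>t. finite (S \<inter> {..t})"
    and "x \<in> insert 0 S"
  shows "\<exists>n. epoch S n = ereal x"
  using assms(3)
proof (induction "card (S \<inter> {..x})" arbitrary: x rule: less_induct)
  case less
  show ?case
  proof (cases "x = 0")
    case True
    then show ?thesis
      by (auto intro!: exI[of _ 0] simp: zero_ereal_def)
  next
    case False
    with less.prems pos have x: "x \<in> S" "0 < x"
      by auto
    define F where "F = insert 0 (S \<inter> {..<x})"
    have F: "finite F" "F \<noteq> {}"
      by (auto simp: F_def intro: finite_subset[OF _ fin[of x]])
    define z where "z = Max F"
    have z: "z \<in> insert 0 S" "z < x"
      using Max_in[OF F] x by (auto simp: F_def z_def)
    have zmax: "w \<le> z" if "w \<in> S" "w < x" for w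
      using that F by (auto simp: F_def z_def)
    have "x \<in> S \<inter> {..x}" "x \<notin> S \<inter> {..z}" "S \<inter> {..z} \<subseteq> S \<inter> {..x}"
      using z x by auto
    then have "S \<inter> {..z} \<subset> S \<inter> {..x}"
      by blast
    then have "card (S \<inter> {..z}) < card (S \<inter> {..x})"
      by (rule psubset_card_mono[OF fin])
    from less.hyps[OF this z(1)] obtain n where n: "epoch S n = ereal z"
      by auto
    have "epoch S (Suc n) = ereal x"
      using n x(1) z(2) by (rule epoch_Suc_eq) (use zmax in force)
    then show ?thesis
      by blast
  qed
qed

lemma gap_after_epoch_iff:
  assumes fin: "\<And>t. finite (S \<inter> {..t})" and x: "epoch S n = ereal x"
  shows "epoch S (Suc n) - epoch S n \<ge> ereal l \<longleftrightarrow> \<not> (\<exists>y\<in>S. x < y \<and> y < x + l)"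
proof (cases "\<exists>z\<in>S. x < z")
  case True
  then obtain z where "z \<in> S" "x < z"
    by blast
  from next_point[OF fin this] obtain y
    where y: "y \<in> S" "x < y" "\<And>z. z \<in> S \<Longrightarrow> x < z \<Longrightarrow> y \<le> z"
    by blast
  have "epoch S (Suc n) - epoch S n = ereal (y - x)"
    using epoch_Suc_eq[OF x y] x by (simp del: epoch.simps)
  then show ?thesis
    using y by (force simp del: epoch.simps)
next
  case False
  then have "{z \<in> S. epoch S n < ereal z} = {}"
    using x by auto
  then have "epoch S (Suc n) = \<infinity>"
    by (simp only: epoch.simps image_empty Inf_empty top_ereal_def)
  then have "epoch S (Suc n) - epoch S n = \<infinity>"
    using x by (simp del: epoch.simps)
  then show ?thesis
    using False by (auto simp del: epoch.simps)
qed

text \<open>The infimum in \<^const>\<open>first_gap\<close> runs over starting points of gaps, and \<^const>\<open>covered\<close> says that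
  all of these lie beyond \<open>t\<close>. The strict inequality passes to the infimum because only finitely
  many points lie in \<open>{t<..t + 1}\<close>.\<close>

lemma first_gap_greater_iff:
  assumes pos: "S \<subseteq> {0<..}" and fin: "\<And>t. finite (S \<inter> {..t})"
  shows "ereal t < first_gap l S \<longleftrightarrow> covered l S t"
proof
  assume t: "ereal t < first_gap l S"
  show "covered l S t"
    unfolding covered_def
  proof (intro ballI impI, rule ccontr)
    fix x assume x: "x \<in> insert 0 S" "x \<le> t" and no: "\<not> (\<exists>y\<in>S. x < y \<and> y < x + l)"
    obtain n where n: "epoch S n = ereal x"
      using epoch_surj[OF pos fin x(1)] by blast
    have "epoch S n < \<infinity> \<and> epoch S (Suc n) - epoch S n \<ge> ereal l"
      using n no gap_after_epoch_iff[OF fin n, of l] by (simp del: epoch.simps)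
    then have "first_gap l S \<le> epoch S n"
      unfolding first_gap_def by (intro Inf_lower) blast
    also have "\<dots> \<le> ereal t"
      using n x by simp
    finally show False
      using t by simp
  qed
next
  assume cov: "covered l S t"
  define F where "F = insert (t + 1) (insert 0 S \<inter> {t<..t + 1})"
  have F: "finite F" "F \<noteq> {}"
    by (auto simp: F_def Int_insert_left intro: finite_subset[OF _ fin[of "t + 1"]])
  have "t < Min F"
    using Min_in[OF F] by (auto simp: F_def)
  moreover have "ereal (Min F) \<le> first_gap l S"
    unfolding first_gap_def
  proof (rule Inf_greatest, clarify)
    fix n assume n: "epoch S n < \<infinity>" "ereal l \<le> epoch S (Suc n) - epoch S n"
    obtain x where x: "x \<in> insert 0 S" "epoch S n = ereal x"
      using epoch_finite_in[OF fin n(1)] by blast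
    have "t < x"
      using cov x(1) gap_after_epoch_iff[OF fin x(2), of l] n(2) unfolding covered_def by force
    have "Min F \<le> x"
    proof (cases "x \<le> t + 1")
      case True
      then show ?thesis
        using \<open>t < x\<close> x(1) by (intro Min_le F) (auto simp: F_def)
    next
      case False
      have "Min F \<le> t + 1"
        by (intro Min_le F) (simp add: F_def)
      with False show ?thesis
        by simp
    qed
    then show "ereal (Min F) \<le> epoch S n"
      using x by simp
  qed
  ultimately show "ereal t < first_gap l S"
    using less_le_trans[of "ereal t" "ereal (Min F)"] by simp
qed

section \<open>Gaps seen on a grid\<close>

definition cell :: "real \<Rightarrow> nat \<Rightarrow> real set" where
  "cell h j = {real j * h<..real (Suc j) * h}"

lemma cell_exists:
  assumes "h > 0" "x > 0"
  obtains j where "x \<in> cell h j"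
proof -
  define j where "j = nat (\<lceil>x / h\<rceil> - 1)"
  have "0 < \<lceil>x / h\<rceil>"
    using assms by simp
  then have "real j = \<lceil>x / h\<rceil> - 1"
    by (simp add: j_def)
  then have "real j < x / h" "x / h \<le> real (Suc j)"
    by linarith+
  then have "x \<in> cell h j"
    using assms by (auto simp: cell_def field_simps)
  then show thesis ..
qed

lemma cell_exists_between:
  assumes h: "h > 0" and x: "real a * h < x" "x \<le> real b * h"
  shows "\<exists>j\<in>{a..<b}. x \<in> cell h j"
proof -
  have "0 < x"
    using x h by (meson le_less_trans mult_nonneg_nonneg of_nat_0_le_iff less_imp_le)
  with h obtain j where j: "x \<in> cell h j"
    using cell_exists by blast
  have "real j * h < real b * h" "real a * h < real (Suc j) * h"
    using j x by (auto simp: cell_def)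
  then have "real j < real b" "real a < real (Suc j)"
    using h mult_less_cancel_right_pos by blast+
  with j show ?thesis
    by auto
qed

text \<open>The last point \<open>x\<close> before the block is followed by a point closer than \<open>l\<close>, the length of the
  block. By the choice of \<open>x\<close> this point is not before the block, and so lies in it.\<close>

lemma covered_imp_blocks_hit:
  assumes fin: "\<And>t. finite (S \<inter> {..t})"
    and h: "h > 0" "real K * h = l" and cov: "covered l S t" and a: "real a * h \<le> t"
  shows "\<exists>i\<in>{a..<a + K}. S \<inter> cell h i \<noteq> {}"
proof -
  obtain x where x: "x \<in> insert 0 S" "x \<le> real a * h"
      "\<And>z. z \<in> S \<Longrightarrow> z \<le> real a * h \<Longrightarrow> z \<le> x"
    using last_point[OF fin, of "real a * h"] h by (metis mult_nonneg_nonneg of_nat_0_le_iff less_imp_le)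
  obtain y where y: "y \<in> S" "x < y" "y < x + l"
    using cov x a unfolding covered_def by force
  have "real a * h < y"
    using x(3)[OF y(1)] y(2) by force
  moreover have "y \<le> real (a + K) * h"
    using y x h by (simp add: algebra_simps)
  ultimately show ?thesis
    using cell_exists_between[OF h(1)] y(1) by blast
qed

text \<open>One cell is given away: the block of \<open>K\<close> cells after the cell of \<open>x\<close> contains a point, and the
  \<open>K + 1\<close> cells involved have total length \<open>l\<close>.\<close>

lemma blocks_hit_imp_covered:
  assumes pos: "S \<subseteq> {0<..}"
    and h: "h > 0" "real (Suc K) * h = l" and M: "t + l \<le> real M * h" and t: "0 \<le> t"
    and hit: "\<And>a. a + K \<le> M \<Longrightarrow> \<exists>i\<in>{a..<a + K}. S \<inter> cell h i \<noteq> {}"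
  shows "covered l S t"
  unfolding covered_def
proof (intro ballI impI)
  have block: "\<exists>y\<in>S. real a * h < y \<and> y \<le> real (a + K) * h" if a: "a + K \<le> M" for a
  proof -
    obtain i y where i: "a \<le> i" "Suc i \<le> a + K" and y: "y \<in> S" "y \<in> cell h i"
      using hit[OF a] by fastforce
    have "real a * h \<le> real i * h" "real (Suc i) * h \<le> real (a + K) * h"
      using i h by (intro mult_right_mono; simp)+
    with y show ?thesis
      by (intro bexI[of _ y]) (auto simp: cell_def)
  qed
  have le_M: "b \<le> M" if "real b * h \<le> t + l" for b
  proof -
    have "real b * h \<le> real M * h"
      using that M by linarith
    then show ?thesis
      using h by simp
  qed
  fix x assume x: "x \<in> insert 0 S" "x \<le> t"
  show "\<exists>y\<in>S. x < y \<and> y < x + l"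
  proof (cases "x = 0")
    case True
    have "K \<le> M"
      using h t by (intro le_M) (simp add: algebra_simps)
    then show ?thesis
      using block[of 0] h True by (force simp: algebra_simps)
  next
    case False
    with x pos have "x > 0"
      by auto
    with h obtain j where j: "x \<in> cell h j"
      using cell_exists by blast
    have "Suc j + K \<le> M"
      using j x h by (intro le_M) (simp add: cell_def algebra_simps)
    from block[OF this] j show ?thesis
      using h by (force simp: cell_def algebra_simps)
  qed
qed

text \<open>A description by countably many conditions of the form \<open>S \<inter> A = {}\<close>, used to show that the
  event is measurable. The point following \<open>x\<close> is strictly inside \<open>{x<..<x + l}\<close>; as only finitely
  many \<open>x\<close> matter, the margin is uniform, and the position of \<open>x\<close> may be replaced by its cell
  on a grid finer than the margin.\<close>

lemma covered_iff_grid: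
  assumes pos: "S \<subseteq> {0<..}" and fin: "\<And>t. finite (S \<inter> {..t})" and t: "0 \<le> t"
  shows "covered l S t \<longleftrightarrow> S \<inter> {0<..<l} \<noteq> {} \<and>
    (\<exists>n. \<forall>j. let h = 1 / real (Suc n) in S \<inter> (cell h j \<inter> {..t}) \<noteq> {} \<longrightarrow>
       S \<inter> {real (Suc j) * h<..<real j * h + l} \<noteq> {})"
    (is "?L \<longleftrightarrow> ?R0 \<and> (\<exists>n. ?B n)")
proof
  assume ?L
  then have ?R0
    using t pos by (force simp: covered_def)
  moreover have "\<exists>n. ?B n"
  proof -
    define g where "g x = (SOME y. y \<in> S \<and> x < y \<and> y < x + l)" for x
    have g: "g x \<in> S" "x < g x" "g x < x + l" if "x \<in> S \<inter> {..t}" for x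
      using that \<open>?L\<close> someI_ex[of "\<lambda>y. y \<in> S \<and> x < y \<and> y < x + l"]
      unfolding covered_def g_def by blast+
    define F where "F = insert 1 ((\<lambda>x. min (g x - x) (x + l - g x)) ` (S \<inter> {..t}))"
    have F: "finite F" "F \<noteq> {}"
      using fin by (auto simp: F_def)
    have "0 < Min F"
      using F g by (auto simp: F_def)
    then obtain n where n: "1 / real (Suc n) < Min F"
      using nat_approx_posE by blast
    define h where "h = 1 / real (Suc n)"
    have "S \<inter> {real (Suc j) * h<..<real j * h + l} \<noteq> {}" if hit: "S \<inter> (cell h j \<inter> {..t}) \<noteq> {}" for j
    proof -
      obtain x where x: "x \<in> S \<inter> {..t}" "x \<in> cell h j"
        using hit by auto
      have "Min F \<le> min (g x - x) (x + l - g x)"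
        using x F by (intro Min_le) (auto simp: F_def)
      with n have "h < g x - x" "h < x + l - g x"
        by (auto simp: h_def)
      then have "g x \<in> {real (Suc j) * h<..<real j * h + l}"
        using x by (auto simp: cell_def algebra_simps)
      with g[OF x(1)] show ?thesis
        by blast
    qed
    then have "?B n"
      by (simp add: h_def Let_def)
    then show ?thesis ..
  qed
  ultimately show "?R0 \<and> (\<exists>n. ?B n)"
    by blast
next
  assume R: "?R0 \<and> (\<exists>n. ?B n)"
  then obtain n where n: "?B n"
    by blast
  define h where "h = 1 / real (Suc n)"
  have h: "h > 0"
    by (simp add: h_def)
  show ?L
    unfolding covered_def
  proof (intro ballI impI)
    fix x assume x: "x \<in> insert 0 S" "x \<le> t"
    show "\<exists>y\<in>S. x < y \<and> y < x + l"
    proof (cases "x = 0")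
      case True
      then show ?thesis
        using R by auto
    next
      case False
      with x pos have "x > 0" "x \<in> S"
        by auto
      with h obtain j where j: "x \<in> cell h j"
        using cell_exists by blast
      with x \<open>x \<in> S\<close> have "S \<inter> (cell h j \<inter> {..t}) \<noteq> {}"
        by auto
      with n have "S \<inter> {real (Suc j) * h<..<real j * h + l} \<noteq> {}"
        by (simp add: h_def Let_def)
      with j show ?thesis
        by (force simp: cell_def)
    qed
  qed
qed

section \<open>Runs of failures in independent trials\<close>

text \<open>\<open>no_long_run K X r j n\<close>: the trials \<open>X j, \<dots>, X (j + n - 1)\<close>, preceded by a run of \<open>r\<close> failures,
  contain no run of \<open>K\<close> failures. The current run length is carried along so that the event obeys a
  one-step recursion.\<close>

fun no_long_run :: "nat \<Rightarrow> (nat \<Rightarrow> bool) \<Rightarrow> nat \<Rightarrow> nat \<Rightarrow> nat \<Rightarrow> bool" where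
  "no_long_run K X r j 0 \<longleftrightarrow> r < K"
| "no_long_run K X r j (Suc n) \<longleftrightarrow>
     r < K \<and> no_long_run K X (if X j then 0 else Suc r) (Suc j) n"

fun run_prob :: "nat \<Rightarrow> (nat \<Rightarrow> real) \<Rightarrow> nat \<Rightarrow> nat \<Rightarrow> nat \<Rightarrow> real" where
  "run_prob K p r j 0 = (if r < K then 1 else 0)"
| "run_prob K p r j (Suc n) = (if r < K then
     p j * run_prob K p 0 (Suc j) n + (1 - p j) * run_prob K p (Suc r) (Suc j) n else 0)"

lemma no_long_run_imp_less: "no_long_run K X r j n \<Longrightarrow> r < K"
  by (cases n) auto

text \<open>The accumulated run is made of actual trials \<open>j - r, \<dots>, j - 1\<close>, so that a window may start there.\<close>

lemma no_long_run_iff_after_failures: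
  assumes "r \<le> j" "\<And>i. j - r \<le> i \<Longrightarrow> i < j \<Longrightarrow> \<not> X i" "r < K"
  shows "no_long_run K X r j n \<longleftrightarrow>
    (\<forall>a. j - r \<le> a \<longrightarrow> a + K \<le> j + n \<longrightarrow> (\<exists>i\<in>{a..<a + K}. X i))"
  using assms
proof (induction n arbitrary: r j)
  case 0
  then show ?case by auto
next
  case (Suc n)
  consider "X j" | "\<not> X j" "Suc r < K" | "\<not> X j" "Suc r = K"
    using Suc.prems by linarith
  then show ?case
  proof cases
    case 1
    have "no_long_run K X r j (Suc n) \<longleftrightarrow>
        (\<forall>a. Suc j \<le> a \<longrightarrow> a + K \<le> Suc j + n \<longrightarrow> (\<exists>i\<in>{a..<a + K}. X i))"
      using Suc.IH[of 0 "Suc j"] Suc.prems 1 by simp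
    also have "\<dots> \<longleftrightarrow> (\<forall>a. j - r \<le> a \<longrightarrow> a + K \<le> j + Suc n \<longrightarrow> (\<exists>i\<in>{a..<a + K}. X i))"
    proof -
      have "\<exists>i\<in>{a..<a + K}. X i" if "j - r \<le> a" "a \<le> j" for a
        using that Suc.prems 1 by (intro bexI[of _ j]) auto
      moreover have "j - r \<le> a" if "Suc j \<le> a" for a
        using that by simp
      ultimately show ?thesis
        by (metis not_less_eq_eq add_Suc_right add_Suc)
    qed
    finally show ?thesis .
  next
    case 2
    have "\<not> X i" if "Suc j - Suc r \<le> i" "i < Suc j" for i
      using that Suc.prems 2 by (cases "i = j") auto
    then show ?thesis
      using Suc.IH[of "Suc r" "Suc j"] Suc.prems 2 by simp
  next
    case 3
    have "\<not> X i" if "i \<in> {j - r..<j - r + K}" for i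
      using that Suc.prems 3 by (cases "i = j") auto
    moreover have "j - r + K \<le> j + Suc n"
      using Suc.prems 3 by simp
    moreover have "\<not> no_long_run K X r j (Suc n)"
      using 3 no_long_run_imp_less[of K X K] by auto
    ultimately show ?thesis
      by blast
  qed
qed

lemma no_long_run_iff:
  assumes "0 < K"
  shows "no_long_run K X 0 j n \<longleftrightarrow>
    (\<forall>a\<ge>j. a + K \<le> j + n \<longrightarrow> (\<exists>i\<in>{a..<a + K}. X i))"
  using no_long_run_iff_after_failures[of 0 j X K n] assms by auto

context prob_space
begin

text \<open>The event concerns trials from \<open>j\<close> on and so is independent of the outcomes \<open>b\<close> of the earlier
  ones. Carrying such a pattern \<open>A\<close> through the induction uses independence
  only in the form of the product formula for patterns.\<close>

lemma prob_no_long_run_pattern: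
  fixes X :: "nat \<Rightarrow> 'a \<Rightarrow> bool" and b :: "nat \<Rightarrow> bool" and K :: nat
  assumes indep: "\<And>n. indep_vars (\<lambda>_. count_space UNIV) X {..<n}"
    and "a \<le> j"
  defines "A \<equiv> \<lambda>b j. {\<omega> \<in> space M. \<forall>i\<in>{a..<j}. X i \<omega> = b i}"
    and "E \<equiv> \<lambda>r j n. {\<omega> \<in> space M. no_long_run K (\<lambda>i. X i \<omega>) r j n}"
    and "p \<equiv> \<lambda>i. prob {\<omega> \<in> space M. X i \<omega>}"
  shows "E r j n \<in> events" "prob (A b j \<inter> E r j n) = prob (A b j) * run_prob K p r j n"
proof -
  have meas[measurable]: "X i \<in> measurable M (count_space UNIV)" for i
    using indep[of "Suc i"] by (auto simp: indep_vars_def)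
  have A[measurable]: "A b j \<in> events" for b j
    unfolding A_def by measurable
  have E: "E r j n \<in> events" for r j n
  proof (induction n arbitrary: r j)
    case 0
    show ?case
      unfolding E_def by simp
  next
    case (Suc n)
    have "E r j (Suc n) = (if r < K then
        ({\<omega> \<in> space M. X j \<omega>} \<inter> E 0 (Suc j) n) \<union>
        ({\<omega> \<in> space M. \<not> X j \<omega>} \<inter> E (Suc r) (Suc j) n) else {})"
      unfolding E_def by (auto split: if_splits)
    then show ?case
      using Suc[of 0 "Suc j"] Suc[of "Suc r" "Suc j"] by (auto intro!: sets.Un sets.Int)
  qed
  show "E r j n \<in> events"
    by fact
  have pat: "prob (A b (Suc j)) = prob (A b j) * (if b j then p j else 1 - p j)"
    if "a \<le> j" for b j
  proof -
    have prd: "prob (A b j) = (\<Prod>i\<in>{a..<j}. prob {\<omega> \<in> space M. X i \<omega> = b i})" for j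
    proof (cases "{a..<j} = {}")
      case True
      then show ?thesis
        by (simp add: A_def prob_space)
    next
      case False
      have "prob (\<Inter>i\<in>{a..<j}. X i -` {b i} \<inter> space M) =
          (\<Prod>i\<in>{a..<j}. prob (X i -` {b i} \<inter> space M))"
        using False by (intro indep_varsD[OF indep[of j]]) auto
      moreover have "(\<Inter>i\<in>{a..<j}. X i -` {b i} \<inter> space M) = A b j"
        using False by (auto simp: A_def)
      moreover have "X i -` {b i} \<inter> space M = {\<omega> \<in> space M. X i \<omega> = b i}" for i
        by auto
      ultimately show ?thesis
        by simp
    qed
    have "prob {\<omega> \<in> space M. X j \<omega> = b j} = (if b j then p j else 1 - p j)"
      using prob_neg[of "X j"] by (simp add: p_def)
    then show ?thesis
      unfolding prd using that by (simp add: prod.atLeastLessThan_Suc)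
  qed
  show "prob (A b j \<inter> E r j n) = prob (A b j) * run_prob K p r j n"
    using \<open>a \<le> j\<close>
  proof (induction n arbitrary: r j b)
    case 0
    have "A b j \<subseteq> space M"
      by (auto simp: A_def)
    then show ?case
      by (auto simp: E_def Int_absorb2)
  next
    case (Suc n)
    show ?case
    proof (cases "r < K")
      case True
      have upd: "prob (A (b(j := c)) (Suc j)) = prob (A b j) * (if c then p j else 1 - p j)" for c
      proof -
        have "A (b(j := c)) j = A b j"
          by (auto simp: A_def)
        then show ?thesis
          using pat[OF Suc.prems, of "b(j := c)"] by (simp only: fun_upd_same)
      qed
      have "A b j \<inter> E r j (Suc n) = (A (b(j := True)) (Suc j) \<inter> E 0 (Suc j) n) \<union>
          (A (b(j := False)) (Suc j) \<inter> E (Suc r) (Suc j) n)"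
        using True Suc.prems by (auto simp: A_def E_def less_Suc_eq split: if_splits)
      moreover have "(A (b(j := True)) (Suc j) \<inter> E 0 (Suc j) n) \<inter>
          (A (b(j := False)) (Suc j) \<inter> E (Suc r) (Suc j) n) = {}"
        using Suc.prems by (force simp: A_def)
      ultimately have "prob (A b j \<inter> E r j (Suc n)) =
          prob (A (b(j := True)) (Suc j) \<inter> E 0 (Suc j) n) +
          prob (A (b(j := False)) (Suc j) \<inter> E (Suc r) (Suc j) n)"
        using E by (simp add: finite_measure_Union)
      also have "\<dots> = prob (A b j) * run_prob K p r j (Suc n)"
        unfolding Suc.IH[OF le_SucI[OF Suc.prems]] upd
        using True by (simp add: algebra_simps)
      finally show ?thesis .
    qed (simp add: E_def)
  qed
qed

lemma prob_no_long_run: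
  fixes X :: "nat \<Rightarrow> 'a \<Rightarrow> bool"
  assumes indep: "\<And>n. indep_vars (\<lambda>_. count_space UNIV) X {..<n}"
  shows "{\<omega> \<in> space M. no_long_run K (\<lambda>i. X i \<omega>) r j n} \<in> events"
    and "prob {\<omega> \<in> space M. no_long_run K (\<lambda>i. X i \<omega>) r j n} =
      run_prob K (\<lambda>i. prob {\<omega> \<in> space M. X i \<omega>}) r j n"
  using prob_no_long_run_pattern[OF indep order.refl[of j], where K = K and r = r and n = n]
  by (simp_all add: prob_space Int_absorb1 subset_eq)

end

text \<open>This is the expected value of \<open>x\<^sup>-\<^sup>k\<close>, where \<open>k\<close> is the number of trials until
  the next success, on the event that the current run of \<open>r\<close> failures does not reach length \<open>K\<close>.
  For a constant success probability \<open>p\<close> the decay ratio is the \<open>x\<close> for which the value at \<open>r = 0\<close> is 1.\<close>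

definition run_weight :: "nat \<Rightarrow> real \<Rightarrow> real \<Rightarrow> nat \<Rightarrow> real" where
  "run_weight K p x r = (\<Sum>i<K - r. p * (1 - p) ^ i / x ^ Suc i)"

context
  fixes K :: nat and p x :: real
  assumes p: "0 < p" "p < 1" and x: "0 < x"
begin

text \<open>For \<open>run_weight K p x 0 = 1\<close> this says that the weight is an eigenfunction, with eigenvalue \<open>x\<close>,
  of the recursion for \<^const>\<open>run_prob\<close>.\<close>

lemma run_weight_step:
  assumes "r < K"
  shows "x * run_weight K p x r = p + (1 - p) * run_weight K p x (Suc r)"
proof -
  have K: "K - r = Suc (K - Suc r)"
    using assms by simp
  show ?thesis
    unfolding run_weight_def K using x
    by (subst sum.lessThan_Suc_shift) (simp add: distrib_left sum_distrib_left mult_ac)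
qed

lemma run_weight_antimono:
  assumes "r \<le> s"
  shows "run_weight K p x s \<le> run_weight K p x r"
  unfolding run_weight_def using p x assms by (intro sum_mono2) auto

lemma run_weight_nonneg: "0 \<le> run_weight K p x r"
  unfolding run_weight_def using p x by (intro sum_nonneg) auto

text \<open>The right-hand side is a supersolution of the recursion. The factor \<open>p / x\<close> is the smallest
  weight of a surviving run length, attained at \<open>K - 1\<close>; dividing by it makes the bound at least 1
  when no trials are left.\<close>

lemma run_prob_le:
  assumes w: "run_weight K p x 0 \<le> 1"
    and q: "\<And>i. i \<ge> j \<Longrightarrow> 0 \<le> q i \<and> q i \<le> p" and K: "0 < K"
  shows "run_prob K q r j n \<le> x ^ n * run_weight K p x r * (x / p)"
  using q
proof (induction n arbitrary: r j)
  case 0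
  have "p / x = run_weight K p x (K - 1)"
    using K by (simp add: run_weight_def)
  also have "\<dots> \<le> run_weight K p x r" if "r < K"
    using that by (intro run_weight_antimono) simp
  finally have "p / x \<le> run_weight K p x r" if "r < K"
    using that by simp
  then show ?case
    using run_weight_nonneg[of r] p x by (auto simp: field_simps)
next
  case (Suc n)
  show ?case
  proof (cases "r < K")
    case True
    let ?w = "run_weight K p x"
    have qj: "0 \<le> q j" "q j \<le> p" "q j \<le> 1"
      using Suc.prems[of j] p by auto
    have "run_prob K q r j (Suc n) =
        q j * run_prob K q 0 (Suc j) n + (1 - q j) * run_prob K q (Suc r) (Suc j) n"
      using True by simp
    also have "\<dots> \<le> q j * (x ^ n * ?w 0 * (x / p)) + (1 - q j) * (x ^ n * ?w (Suc r) * (x / p))"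
      using qj p Suc.prems by (intro add_mono mult_left_mono Suc.IH) auto
    also have "\<dots> = x ^ n * (x / p) * (q j * ?w 0 + (1 - q j) * ?w (Suc r))"
      using p by (simp add: field_simps)
    also have "\<dots> \<le> x ^ n * (x / p) * (x * ?w r)"
    proof (rule mult_left_mono)
      \<comment> \<open>a higher chance of success only helps, since the weight is largest at run length 0\<close>
      have "q j * (?w 0 - ?w (Suc r)) \<le> p * (1 - ?w (Suc r))"
        using qj w p run_weight_antimono[of 0 "Suc r"] by (intro mult_mono) auto
      then show "q j * ?w 0 + (1 - q j) * ?w (Suc r) \<le> x * ?w r"
        unfolding run_weight_step[OF True] by (simp add: algebra_simps)
    qed (use x p in simp)
    finally show ?thesis
      by (simp add: algebra_simps)
  next
    case False
    then show ?thesis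
      by (simp add: run_weight_def)
  qed
qed

lemma run_prob_ge:
  assumes w: "run_weight K p x 0 \<ge> 1"
    and q: "\<And>i. i \<ge> j \<Longrightarrow> p \<le> q i \<and> q i \<le> 1"
  shows "run_prob K q r j n \<ge> x ^ n * run_weight K p x r / run_weight K p x 0"
  using q
proof (induction n arbitrary: r j)
  case 0
  show ?case
    using w run_weight_antimono[of 0 r] by (auto simp: run_weight_def)
next
  case (Suc n)
  show ?case
  proof (cases "r < K")
    case True
    let ?w = "run_weight K p x"
    have qj: "p \<le> q j" "q j \<le> 1" "0 \<le> q j"
      using Suc.prems[of j] p by auto
    have "x ^ Suc n * ?w r / ?w 0 = x ^ n / ?w 0 * (x * ?w r)"
      by (simp add: algebra_simps)
    also have "\<dots> \<le> x ^ n / ?w 0 * (q j * ?w 0 + (1 - q j) * ?w (Suc r))"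
    proof (rule mult_left_mono)
      have "p * (1 - ?w (Suc r)) \<le> p * (?w 0 - ?w (Suc r))"
        using p w by (intro mult_left_mono) auto
      also have "\<dots> \<le> q j * (?w 0 - ?w (Suc r))"
        using qj run_weight_antimono[of 0 "Suc r"] by (intro mult_right_mono) auto
      finally show "x * ?w r \<le> q j * ?w 0 + (1 - q j) * ?w (Suc r)"
        unfolding run_weight_step[OF True] by (simp add: algebra_simps)
    qed (use x w in simp)
    also have "\<dots> = q j * (x ^ n * ?w 0 / ?w 0) + (1 - q j) * (x ^ n * ?w (Suc r) / ?w 0)"
      using w by (simp add: field_simps)
    also have "\<dots> \<le> q j * run_prob K q 0 (Suc j) n + (1 - q j) * run_prob K q (Suc r) (Suc j) n"
      using qj p Suc.prems by (intro add_mono mult_left_mono Suc.IH) auto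
    also have "\<dots> = run_prob K q r j (Suc n)"
      using True by simp
    finally show ?thesis .
  next
    case False
    then show ?thesis
      by (simp add: run_weight_def)
  qed
qed

end

lemma run_prob_nonneg:
  assumes "\<And>i. 0 \<le> q i \<and> q i \<le> 1"
  shows "0 \<le> run_prob K q r j n"
  using assms by (induction n arbitrary: r j) auto

text \<open>One way to survive the first \<open>m\<close> trials is that all of them succeed.\<close>

lemma run_prob_ge_prod:
  assumes "\<And>i. 0 \<le> q i \<and> q i \<le> 1" "0 < K"
  shows "(\<Prod>i\<in>{j..<j + m}. q i) * run_prob K q 0 (j + m) n \<le> run_prob K q 0 j (m + n)"
proof (induction m arbitrary: j)
  case 0
  then show ?case by simp
next
  case (Suc m)
  have "(\<Prod>i\<in>{j..<j + Suc m}. q i) * run_prob K q 0 (j + Suc m) n =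
      q j * ((\<Prod>i\<in>{Suc j..<Suc j + m}. q i) * run_prob K q 0 (Suc j + m) n)"
    by (simp add: prod.atLeast_Suc_lessThan)
  also have "\<dots> \<le> q j * run_prob K q 0 (Suc j) (m + n)"
    using assms Suc[of "Suc j"] by (intro mult_left_mono) auto
  also have "\<dots> \<le> run_prob K q 0 j (Suc m + n)"
    using assms run_prob_nonneg[of q] by simp
  finally show ?case .
qed

section \<open>The integral equation for the rate\<close>

definition gap_integral :: "real \<Rightarrow> real \<Rightarrow> real \<Rightarrow> real" where
  "gap_integral \<gamma> m L = integral {0..L} (\<lambda>s. m * exp ((\<gamma> - m) * s))"

lemma exp_integrable [simp]: "(\<lambda>s. m * exp (c * s)) integrable_on {a..b::real}"
  by (intro integrable_continuous_interval continuous_intros)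

lemma gap_integral_split:
  assumes "0 \<le> a" "a \<le> b"
  shows "gap_integral \<gamma> m b = gap_integral \<gamma> m a + integral {a..b} (\<lambda>s. m * exp ((\<gamma> - m) * s))"
  unfolding gap_integral_def using assms by (subst Henstock_Kurzweil_Integration.integral_combine) auto

lemma integral_exponential_density:
  fixes m a b :: real
  assumes "a \<le> b"
  shows "((\<lambda>s. m * exp (- m * s)) has_integral exp (- m * a) - exp (- m * b)) {a..b}"
proof -
  have "((\<lambda>s. m * exp (- m * s)) has_integral (- exp (- m * b)) - (- exp (- m * a))) {a..b}"
    using assms by (intro fundamental_theorem_of_calculus)
      (auto intro!: derivative_eq_intros simp: has_real_derivative_iff_has_vector_derivative[symmetric])
  then show ?thesis by simp
qed

text \<open>The integrand is the exponential density times \<open>exp (\<gamma> * s)\<close>, which is frozen at an endpoint of the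
  interval.\<close>

lemma gap_integral_cell_bounds:
  fixes m \<gamma> a b :: real
  assumes m: "0 < m" and \<gamma>: "0 \<le> \<gamma>" and ab: "a \<le> b"
  defines "I \<equiv> integral {a..b} (\<lambda>s. m * exp ((\<gamma> - m) * s))"
    and "d \<equiv> exp (- m * a) - exp (- m * b)"
  shows "exp (\<gamma> * a) * d \<le> I" "I \<le> exp (\<gamma> * b) * d"
proof -
  note d = integral_exponential_density[OF ab, of m, folded d_def]
  have I: "((\<lambda>s. m * exp ((\<gamma> - m) * s)) has_integral I) {a..b}"
    unfolding I_def by (intro integrable_integral) simp
  have eq: "m * exp ((\<gamma> - m) * s) = exp (\<gamma> * s) * (m * exp (- m * s))" for s
    by (simp add: algebra_simps flip: exp_add)
  show "exp (\<gamma> * a) * d \<le> I"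
    by (rule has_integral_le[OF has_integral_mult_right[OF d] I])
      (use m \<gamma> in \<open>auto simp: eq intro!: mult_right_mono mult_left_mono\<close>)
  show "I \<le> exp (\<gamma> * b) * d"
    by (rule has_integral_le[OF I has_integral_mult_right[OF d]])
      (use m \<gamma> in \<open>auto simp: eq intro!: mult_right_mono mult_left_mono\<close>)
qed

text \<open>The \<open>i\<close>-th summand of the weight is the probability that an exponential variable of rate \<open>m\<close> falls
  in the \<open>i\<close>-th cell, times \<open>exp (\<gamma> * s)\<close> at the right end \<open>s\<close> of that cell. So the weight is an upper
  Riemann sum, and overshoots by at most the variation of \<open>exp (\<gamma> * s)\<close> over one cell.\<close>

lemma run_weight_bounds:
  assumes m: "0 < m" and \<gamma>: "0 \<le> \<gamma>" and h: "0 < h"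
  defines "W \<equiv> \<lambda>K. run_weight K (1 - exp (- m * h)) (exp (- \<gamma> * h)) 0"
  shows "gap_integral \<gamma> m (real K * h) \<le> W K"
    and "W K \<le> exp (\<gamma> * h) * gap_integral \<gamma> m (real K * h)"
proof -
  let ?I = "\<lambda>i. integral {real i * h..real (Suc i) * h} (\<lambda>s. m * exp ((\<gamma> - m) * s))"
  let ?d = "\<lambda>i. exp (- m * (real i * h)) - exp (- m * (real (Suc i) * h))"
  have bnd: "exp (\<gamma> * (real i * h)) * ?d i \<le> ?I i" "?I i \<le> exp (\<gamma> * (real (Suc i) * h)) * ?d i" for i
    using h by (intro gap_integral_cell_bounds m \<gamma>; simp)+
  have WS: "W (Suc i) = W i + exp (\<gamma> * (real (Suc i) * h)) * ?d i" for i
  proof -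
    have "W (Suc i) = W i + (1 - exp (- m * h)) * exp (- m * h) ^ i / exp (- \<gamma> * h) ^ Suc i"
      by (simp add: W_def run_weight_def)
    also have "(1 - exp (- m * h)) * exp (- m * h) ^ i / exp (- \<gamma> * h) ^ Suc i =
        exp (\<gamma> * (real (Suc i) * h)) * ?d i"
      by (simp add: exp_minus exp_diff exp_add algebra_simps divide_simps del: power_Suc
          flip: exp_of_nat_mult exp_add)
    finally show ?thesis .
  qed
  have GS: "gap_integral \<gamma> m (real (Suc i) * h) = gap_integral \<gamma> m (real i * h) + ?I i" for i
    using h by (intro gap_integral_split) auto
  have z: "gap_integral \<gamma> m 0 = 0" "W 0 = 0"
    by (simp_all add: gap_integral_def W_def run_weight_def)
  show "gap_integral \<gamma> m (real K * h) \<le> W K"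
  proof (induction K)
    case (Suc K)
    then show ?case
      unfolding WS GS using bnd(2)[of K] by linarith
  qed (simp add: z)
  show "W K \<le> exp (\<gamma> * h) * gap_integral \<gamma> m (real K * h)"
  proof (induction K)
    case (Suc K)
    have "exp (\<gamma> * (real (Suc K) * h)) * ?d K = exp (\<gamma> * h) * (exp (\<gamma> * (real K * h)) * ?d K)"
      by (simp add: algebra_simps flip: exp_add)
    also have "\<dots> \<le> exp (\<gamma> * h) * ?I K"
      using bnd(1)[of K] by (intro mult_left_mono) auto
    finally show ?case
      unfolding WS GS using Suc by (simp add: distrib_left)
  qed (simp add: z)
qed

text \<open>This replaces continuity in the rate: small changes of \<open>m\<close> change the integral by a factor close
  to 1, in either direction.\<close>

lemma gap_integral_rate_le:
  assumes "0 < m" "m \<le> m'"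
  shows "gap_integral \<gamma> m' L \<le> (m' / m) * gap_integral \<gamma> m L"
proof -
  have "gap_integral \<gamma> m' L \<le> integral {0..L} (\<lambda>s. (m' / m) * (m * exp ((\<gamma> - m) * s)))"
    unfolding gap_integral_def
  proof (rule integral_le[OF exp_integrable integrable_on_mult_right[OF exp_integrable]])
    fix s assume "s \<in> {0..L}"
    then have "exp ((\<gamma> - m') * s) \<le> exp ((\<gamma> - m) * s)"
      using assms by (auto intro!: mult_right_mono)
    then have "m' * exp ((\<gamma> - m') * s) \<le> m' * exp ((\<gamma> - m) * s)"
      using assms by (intro mult_left_mono) auto
    then show "m' * exp ((\<gamma> - m') * s) \<le> (m' / m) * (m * exp ((\<gamma> - m) * s))"
      using assms by simp
  qed
  also have "\<dots> = (m' / m) * gap_integral \<gamma> m L"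
    unfolding gap_integral_def by (rule integral_mult_right)
  finally show ?thesis .
qed

text \<open>For \<open>\<gamma> = 0\<close> the integral is the distribution function of an exponential variable, and hence below
  1; this makes the root positive.\<close>

lemma gap_integral_zero_exponent:
  assumes "0 \<le> L"
  shows "gap_integral 0 m L = 1 - exp (- m * L)"
  unfolding gap_integral_def using integral_unique[OF integral_exponential_density[OF assms, of m]]
  by simp

lemma gap_integral_strict_mono:
  assumes "0 < m" "0 < L" "\<gamma> < \<gamma>'"
  shows "gap_integral \<gamma> m L < gap_integral \<gamma>' m L"
  unfolding gap_integral_def
  using assms by (intro integral_less_real[where a = 0 and b = L]) (auto intro!: continuous_intros)

lemma gap_integral_continuous: "continuous_on UNIV (\<lambda>\<gamma>. gap_integral \<gamma> m L)"
proof -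
  have "continuous_on UNIV (\<lambda>\<gamma>. integral (cbox 0 L) (\<lambda>s. m * exp ((\<gamma> - m) * s)))"
    by (intro integral_continuous_on_param) (auto intro!: continuous_intros simp: split_beta)
  then show ?thesis
    by (simp add: gap_integral_def)
qed

text \<open>The half \<open>{L / 2..L}\<close> alone contributes at least \<open>c * exp (\<gamma> * L / 2)\<close>.\<close>

lemma gap_integral_large_exponent:
  assumes "0 < m" "0 < L"
  shows "\<exists>\<gamma>\<ge>0. 1 \<le> gap_integral \<gamma> m L"
proof -
  define c where "c = exp (- m * (L / 2)) - exp (- m * L)"
  have c: "0 < c"
    using assms by (simp add: c_def)
  define \<gamma> where "\<gamma> = max 0 (ln (1 / c) * 2 / L)"
  have "ln (1 / c) \<le> \<gamma> * (L / 2)"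
    using assms by (simp add: \<gamma>_def max_def field_simps)
  then have "1 / c \<le> exp (\<gamma> * (L / 2))"
    using c by (metis exp_le_cancel_iff exp_ln zero_less_divide_1_iff)
  then have "1 \<le> exp (\<gamma> * (L / 2)) * c"
    using c by (simp add: field_simps)
  also have "\<dots> \<le> integral {L/2..L} (\<lambda>s. m * exp ((\<gamma> - m) * s))"
    unfolding c_def by (rule gap_integral_cell_bounds) (use assms in \<open>auto simp: \<gamma>_def\<close>)
  also have "\<dots> \<le> gap_integral \<gamma> m L"
  proof -
    have "0 \<le> gap_integral \<gamma> m (L / 2)"
      unfolding gap_integral_def using assms by (intro integral_nonneg) auto
    then show ?thesis
      using gap_integral_split[of "L / 2" L \<gamma> m] assms by simp
  qed
  finally show ?thesis
    by (intro exI[of _ \<gamma>]) (auto simp: \<gamma>_def)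
qed

lemma gap_integral_root:
  assumes "0 < m" "0 < L"
  obtains \<gamma> where "0 < \<gamma>" "gap_integral \<gamma> m L = 1"
proof -
  obtain g where g: "0 \<le> g" "1 \<le> gap_integral g m L"
    using gap_integral_large_exponent[OF assms] by blast
  have "\<exists>\<gamma>. 0 \<le> \<gamma> \<and> \<gamma> \<le> g \<and> gap_integral \<gamma> m L = 1"
    using g assms by (intro IVT' continuous_on_subset[OF gap_integral_continuous])
      (auto simp: gap_integral_zero_exponent)
  then obtain \<gamma> where "0 \<le> \<gamma>" "gap_integral \<gamma> m L = 1"
    by blast
  moreover have "\<gamma> \<noteq> 0"
    using calculation assms by (auto simp: gap_integral_zero_exponent)
  ultimately show thesis
    using that[of \<gamma>] by simp
qed

lemma gap_integral_large_rate:
  assumes "0 < \<gamma>" "0 < L"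
  shows "\<exists>m>0. 1 < gap_integral \<gamma> m L"
proof -
  have "((\<lambda>m. m * exp (- (m - \<gamma>) * L)) \<longlongrightarrow> 0) at_top"
    using assms by real_asymp
  then have "eventually (\<lambda>m. m * exp (- (m - \<gamma>) * L) < \<gamma>) at_top"
    using assms by (intro order_tendstoD)
  then have "eventually (\<lambda>m. m * exp (- (m - \<gamma>) * L) < \<gamma> \<and> \<gamma> < m) at_top"
    using eventually_gt_at_top[of \<gamma>] by eventually_elim simp
  then obtain m where m: "m * exp (- (m - \<gamma>) * L) < \<gamma>" "\<gamma> < m"
    by (auto simp: eventually_at_top_linorder)
  have "((\<lambda>s. m / (m - \<gamma>) * ((m - \<gamma>) * exp (- (m - \<gamma>) * s))) has_integral
      m / (m - \<gamma>) * (exp (- (m - \<gamma>) * 0) - exp (- (m - \<gamma>) * L))) {0..L}"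
    using assms by (intro has_integral_mult_right integral_exponential_density) simp
  moreover have "m / (m - \<gamma>) * ((m - \<gamma>) * exp (- (m - \<gamma>) * s)) = m * exp ((\<gamma> - m) * s)" for s
    using m by simp
  ultimately have "gap_integral \<gamma> m L = m / (m - \<gamma>) * (1 - exp (- (m - \<gamma>) * L))"
    unfolding gap_integral_def by (intro integral_unique) simp
  moreover have "1 < m / (m - \<gamma>) * (1 - exp (- (m - \<gamma>) * L))"
    using m by (simp add: field_simps)
  ultimately show ?thesis
    using m assms by (intro exI[of _ m]) simp
qed

lemma gap_integral_small_rate:
  assumes "0 < L" "0 \<le> \<gamma>"
  shows "\<exists>m>0. gap_integral \<gamma> m L < 1"
proof -
  define m where "m = 1 / (2 * L * exp (\<gamma> * L))"
  have m: "0 < m"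
    using assms by (simp add: m_def)
  have "gap_integral \<gamma> m L \<le> integral {0..L} (\<lambda>s. m * exp (\<gamma> * L))"
    unfolding gap_integral_def
  proof (rule integral_le[OF exp_integrable])
    fix s assume s: "s \<in> {0..L}"
    have "(\<gamma> - m) * s \<le> \<gamma> * s"
      using m s by (intro mult_right_mono) auto
    also have "\<dots> \<le> \<gamma> * L"
      using assms s by (intro mult_left_mono) auto
    finally show "m * exp ((\<gamma> - m) * s) \<le> m * exp (\<gamma> * L)"
      using m by simp
  qed auto
  also have "\<dots> = 1 / 2"
    using assms by (simp add: m_def)
  finally show ?thesis
    using m by (intro exI[of _ m]) simp
qed

text \<open>The lower bound on the tail works with blocks of one cell less than \<open>L\<close>; on a fine grid this does not
  spoil a strict inequality.\<close>

lemma gap_integral_shorten: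
  assumes "1 < gap_integral \<gamma> m L" "0 < L"
  shows "\<exists>K>0. 1 < gap_integral \<gamma> m (real K * (L / real (Suc K)))"
proof -
  have "continuous_on {0..L} (gap_integral \<gamma> m)"
    unfolding gap_integral_def by (intro indefinite_integral_continuous_1) simp
  moreover have "(\<lambda>K. real K * (L / real (Suc K))) \<longlonglongrightarrow> L"
    using assms by real_asymp
  ultimately have "(\<lambda>K. gap_integral \<gamma> m (real K * (L / real (Suc K)))) \<longlonglongrightarrow> gap_integral \<gamma> m L"
    by (rule continuous_on_tendsto_compose) (use assms in \<open>auto simp: field_simps\<close>)
  then have "eventually (\<lambda>K. 1 < gap_integral \<gamma> m (real K * (L / real (Suc K)))) sequentially"
    using assms by (intro order_tendstoD)
  then have "eventually (\<lambda>K. 0 < K \<and> 1 < gap_integral \<gamma> m (real K * (L / real (Suc K)))) sequentially"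
    using eventually_gt_at_top[of 0] by eventually_elim simp
  then show ?thesis
    by (auto simp: eventually_at_top_linorder)
qed

lemma gap_integral_fine_grid:
  assumes "gap_integral \<gamma> m L < 1"
  shows "\<exists>K>0. exp (\<gamma> * (L / real K)) * gap_integral \<gamma> m L \<le> 1"
proof -
  have "(\<lambda>K. exp (\<gamma> * (L / real K)) * gap_integral \<gamma> m L) \<longlonglongrightarrow> exp (\<gamma> * 0) * gap_integral \<gamma> m L"
    by real_asymp
  then have "eventually (\<lambda>K. exp (\<gamma> * (L / real K)) * gap_integral \<gamma> m L < 1) sequentially"
    using assms by (intro order_tendstoD) auto
  then have "eventually (\<lambda>K. 0 < K \<and> exp (\<gamma> * (L / real K)) * gap_integral \<gamma> m L \<le> 1) sequentially"
    using eventually_gt_at_top[of 0] by eventually_elim simp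
  then show ?thesis
    by (auto simp: eventually_at_top_linorder)
qed

section \<open>Logarithmic decay rates\<close>

lemma elog_mono: "x \<le> y \<Longrightarrow> elog x \<le> elog y"
  by (auto simp: elog_def)

text \<open>A constant factor is invisible at the scale \<open>t\<close>, at the price of the arbitrarily small loss
  \<open>\<gamma> - a\<close> in the exponent. This covers \<open>f t = 0\<close>, where the rate is \<open>\<infinity>\<close>.\<close>

lemma log_decay_rate_gt:
  assumes C: "0 < C" and le: "eventually (\<lambda>t. f t \<le> C * exp (- \<gamma> * t)) at_top" and a: "a < \<gamma>"
  shows "eventually (\<lambda>t. ereal a < - elog (f t) / ereal t) at_top"
proof -
  have "eventually (\<lambda>t::real. ln C < (\<gamma> - a) * t) at_top"
    using a by real_asymp
  with le eventually_gt_at_top[of 0] show ?thesis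
  proof eventually_elim
    case (elim t)
    have "elog (f t) \<le> elog (C * exp (- \<gamma> * t))"
      using elim by (intro elog_mono)
    also have "\<dots> = ereal (ln C - \<gamma> * t)"
      using C by (simp add: elog_def ln_mult mult_le_0_iff)
    also have "\<dots> < ereal (- a * t)"
      using elim by (simp add: algebra_simps)
    finally have "elog (f t) < ereal (- a * t)" .
    then show ?case
      using elim by (cases "elog (f t)") (auto simp: field_simps)
  qed
qed

lemma log_decay_rate_lt:
  assumes c: "0 < c" and ge: "eventually (\<lambda>t. c * exp (- \<gamma> * t) \<le> f t) at_top" and a: "\<gamma> < a"
  shows "eventually (\<lambda>t. - elog (f t) / ereal t < ereal a) at_top"
proof -
  have "eventually (\<lambda>t::real. (\<gamma> - a) * t < ln c) at_top"
    using a by real_asymp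
  with ge eventually_gt_at_top[of 0] show ?thesis
  proof eventually_elim
    case (elim t)
    have "ereal (- a * t) < ereal (ln c - \<gamma> * t)"
      using elim by (simp add: algebra_simps)
    also have "\<dots> = elog (c * exp (- \<gamma> * t))"
      using c by (simp add: elog_def ln_mult mult_le_0_iff)
    also have "\<dots> \<le> elog (f t)"
      using elim by (intro elog_mono)
    finally have "ereal (- a * t) < elog (f t)" .
    then show ?case
      using elim by (cases "elog (f t)") (auto simp: field_simps)
  qed
qed

lemma approx_log_exp:
  assumes g: "0 < \<gamma>" and lim: "((\<lambda>t. - elog (f t) / ereal t) \<longlongrightarrow> ereal \<gamma>) at_top"
  shows "f \<approx>log (\<lambda>t. exp (- \<gamma> * t))"
  unfolding approx_log_def
proof (rule Lim_transform_eventually)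
  show "((\<lambda>t. ereal (1 / \<gamma>) * (- elog (f t) / ereal t)) \<longlongrightarrow> 1) at_top"
    using tendsto_mult_ereal[OF tendsto_const[of "ereal (1 / \<gamma>)"] lim] g
    by (simp add: one_ereal_def)
  show "eventually (\<lambda>t. ereal (1 / \<gamma>) * (- elog (f t) / ereal t) =
      elog (f t) / elog (exp (- \<gamma> * t))) at_top"
    using eventually_gt_at_top[of 0]
  proof eventually_elim
    case (elim t)
    have "0 < \<gamma> * t"
      using g elim by simp
    moreover have "elog (exp (- \<gamma> * t)) = ereal (- \<gamma> * t)"
      by (simp add: elog_def)
    ultimately show ?case
      using g elim by (cases "elog (f t)") (auto simp: mult_le_0_iff)
  qed
qed

section \<open>The intensity of an interval\<close>

lemma emeasure_intensity:
  assumes [measurable]: "\<mu> \<in> borel_measurable borel" and "0 \<le> a"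
  shows "emeasure (intensity \<mu>) {a<..b} = (\<integral>\<^sup>+ t\<in>{a<..b}. ennreal (\<mu> t) \<partial>lborel)"
proof -
  have "emeasure (intensity \<mu>) {a<..b} =
      (\<integral>\<^sup>+ t. ennreal (\<mu> t) * indicator {0<..} t * indicator {a<..b} t \<partial>lborel)"
    unfolding intensity_def by (subst emeasure_density) auto
  also have "\<dots> = (\<integral>\<^sup>+ t\<in>{a<..b}. ennreal (\<mu> t) \<partial>lborel)"
    using assms(2) by (intro nn_integral_cong) (auto split: split_indicator)
  finally show ?thesis .
qed

lemma emeasure_intensity_finite:
  assumes "\<mu> \<in> borel_measurable borel" and "0 \<le> a"
    and "\<And>t. cumulative_rate \<mu> 0 t < \<infinity>"
  shows "emeasure (intensity \<mu>) {a<..b} < \<infinity>"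
proof -
  have "emeasure (intensity \<mu>) {a<..b} \<le> cumulative_rate \<mu> 0 b"
    unfolding emeasure_intensity[OF assms(1,2)] cumulative_rate_def using assms(2)
    by (intro nn_integral_mono) (auto split: split_indicator)
  with assms(3)[of b] show ?thesis
    by (rule le_less_trans[rotated])
qed

lemma measure_intensity_le:
  assumes "\<mu> \<in> borel_measurable borel" and "0 \<le> a" "a \<le> b" "0 \<le> m"
    and "\<And>t. a < t \<Longrightarrow> \<mu> t \<le> m"
  shows "measure (intensity \<mu>) {a<..b} \<le> m * (b - a)"
proof -
  have "emeasure (intensity \<mu>) {a<..b} \<le> (\<integral>\<^sup>+ t\<in>{a<..b}. ennreal m \<partial>lborel)"
    unfolding emeasure_intensity[OF assms(1,2)]
    using assms by (intro nn_integral_mono) (auto split: split_indicator intro!: ennreal_leI)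
  also have "\<dots> = ennreal (m * (b - a))"
    using assms by (simp add: nn_integral_cmult_indicator ennreal_mult)
  finally show ?thesis
    using assms by (simp add: measure_def enn2real_leI)
qed

lemma measure_intensity_ge:
  assumes "\<mu> \<in> borel_measurable borel" and "0 \<le> a" "a \<le> b" "0 \<le> m"
    and "\<And>t. cumulative_rate \<mu> 0 t < \<infinity>"
    and "\<And>t. a < t \<Longrightarrow> m \<le> \<mu> t"
  shows "m * (b - a) \<le> measure (intensity \<mu>) {a<..b}"
proof -
  have "ennreal (m * (b - a)) = (\<integral>\<^sup>+ t\<in>{a<..b}. ennreal m \<partial>lborel)"
    using assms by (simp add: nn_integral_cmult_indicator ennreal_mult)
  also have "\<dots> \<le> emeasure (intensity \<mu>) {a<..b}"
    unfolding emeasure_intensity[OF assms(1,2)]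
    using assms by (intro nn_integral_mono) (auto split: split_indicator intro!: ennreal_leI)
  also have "\<dots> = ennreal (measure (intensity \<mu>) {a<..b})"
    using emeasure_intensity_finite[OF assms(1,2,5), of b] by (simp add: emeasure_eq_ennreal_measure)
  finally show ?thesis
    by simp
qed

lemma measure_intensity_pos:
  assumes [measurable]: "\<mu> \<in> borel_measurable borel" and "0 \<le> a" "a < b"
    and "\<And>t. cumulative_rate \<mu> 0 t < \<infinity>"
    and pos: "AE t in lborel. t \<ge> 0 \<longrightarrow> \<mu> t > 0"
  shows "0 < measure (intensity \<mu>) {a<..b}"
proof -
  have "emeasure (intensity \<mu>) {a<..b} \<noteq> 0"
  proof
    assume "emeasure (intensity \<mu>) {a<..b} = 0"
    then have "AE t in lborel. ennreal (\<mu> t) * indicator {a<..b} t = 0"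
      unfolding emeasure_intensity[OF assms(1,2)]
      by (subst (asm) nn_integral_0_iff_AE) auto
    with pos have "AE t in lborel. t \<notin> {a<..b}"
      by eventually_elim (use assms(2) in \<open>auto split: split_indicator_asm simp: ennreal_eq_0_iff\<close>)
    then have "emeasure lborel {a<..b} = 0"
      by (subst (asm) AE_iff_measurable[of "{a<..b}"]) auto
    then show False
      using assms by simp
  qed
  then show ?thesis
    using emeasure_intensity_finite[OF assms(1,2,4), of b]
    by (simp add: measure_def enn2real_positive_iff zero_less_iff_neq_zero)
qed

section \<open>Occupied cells of a Poisson process\<close>

text \<open>Stated through the count, so that independence of the counts carries over for all \<open>\<omega>\<close>; on the
  sample space it means that the cell contains a point.\<close>

definition hits :: "('a \<Rightarrow> real set) \<Rightarrow> real \<Rightarrow> nat \<Rightarrow> 'a \<Rightarrow> bool" where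
  "hits N h i \<omega> \<longleftrightarrow> card (N \<omega> \<inter> cell h i) \<noteq> 0"

lemma cell_borel [simp]: "cell h j \<in> sets borel"
  and cell_bounded [simp]: "bounded (cell h j)"
  unfolding cell_def by (auto intro: bounded_subset[OF bounded_closed_interval])

lemma disjoint_cells:
  assumes "0 \<le> h"
  shows "disjoint_family_on (cell h) I"
proof -
  have "cell h i \<inter> cell h j = {}" if "i < j" for i j
  proof -
    have "real (Suc i) * h \<le> real j * h"
      using that assms by (intro mult_right_mono) auto
    then show ?thesis
      by (auto simp: cell_def)
  qed
  then show ?thesis
    unfolding disjoint_family_on_def by (metis Int_commute linorder_neqE_nat)
qed

lemma finite_Int_bounded:
  fixes S :: "real set"
  assumes fin: "\<And>t. finite (S \<inter> {..t})" and "bounded A"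
  shows "finite (S \<inter> A)"
proof -
  obtain B where "\<And>x. x \<in> A \<Longrightarrow> \<bar>x\<bar> \<le> B"
    using assms(2) by (auto simp: bounded_iff)
  then have "S \<inter> A \<subseteq> S \<inter> {..B}"
    by (auto dest: abs_le_D1)
  then show ?thesis
    using fin finite_subset by blast
qed

context
  fixes P :: "'a measure" and N :: "'a \<Rightarrow> real set" and \<Lambda> :: "real measure"
  assumes ppp: "poisson_point_process P N \<Lambda>"
begin

interpretation prob_space P
  using ppp by (simp add: poisson_point_process_def)

lemma realisation_pos: "\<omega> \<in> space P \<Longrightarrow> N \<omega> \<subseteq> {0<..}"
  and realisation_finite: "\<omega> \<in> space P \<Longrightarrow> finite (N \<omega> \<inter> {..t})"
  using ppp by (auto simp: poisson_point_process_def)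

lemma card_eq_0_iff_disjoint:
  assumes "\<omega> \<in> space P" "bounded A"
  shows "card (N \<omega> \<inter> A) = 0 \<longleftrightarrow> N \<omega> \<inter> A = {}"
  using finite_Int_bounded[OF realisation_finite assms(2)] assms(1) by auto

lemma hit_measurable:
  assumes "A \<in> sets borel" "bounded A"
  shows "Measurable.pred P (\<lambda>\<omega>. N \<omega> \<inter> A \<noteq> {})"
proof -
  have [measurable]: "(\<lambda>\<omega>. card (N \<omega> \<inter> A)) \<in> measurable P (count_space UNIV)"
    using ppp assms by (simp add: poisson_point_process_def)
  have "Measurable.pred P (\<lambda>\<omega>. card (N \<omega> \<inter> A) \<noteq> 0)"
    by measurable
  then show ?thesis
    by (rule measurable_cong[THEN iffD1, rotated]) (use card_eq_0_iff_disjoint assms in auto)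
qed

lemma prob_hits:
  "prob {\<omega> \<in> space P. hits N h i \<omega>} = 1 - exp (- measure \<Lambda> (cell h i))"
proof -
  have m: "(\<lambda>\<omega>. card (N \<omega> \<inter> cell h i)) \<in> measurable P (count_space UNIV)"
    and "prob {\<omega> \<in> space P. card (N \<omega> \<inter> cell h i) = k} =
      measure \<Lambda> (cell h i) ^ k / fact k * exp (- measure \<Lambda> (cell h i))" for k
    using ppp by (simp_all add: poisson_point_process_def)
  from this(2)[of 0]
  have "prob {\<omega> \<in> space P. card (N \<omega> \<inter> cell h i) = 0} = exp (- measure \<Lambda> (cell h i))"
    by simp
  moreover have "{\<omega> \<in> space P. card (N \<omega> \<inter> cell h i) = 0} \<in> events"
    using m by measurable
  ultimately show ?thesis
    unfolding hits_def using prob_neg[of "\<lambda>\<omega>. card (N \<omega> \<inter> cell h i) = 0"] by simp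
qed

lemma indep_hits:
  assumes "0 \<le> h"
  shows "indep_vars (\<lambda>_. count_space UNIV) (hits N h) {..<n}"
proof -
  have "indep_vars (\<lambda>_. count_space UNIV) (\<lambda>i \<omega>. card (N \<omega> \<inter> cell h i)) {..<n}"
    using ppp disjoint_cells[OF assms, of "{..<n}"] by (simp add: poisson_point_process_def)
  from indep_vars_compose2[OF this, of "\<lambda>_ k. k \<noteq> 0"] show ?thesis
    by (simp add: hits_def[abs_def])
qed

lemma first_gap_measurable:
  assumes t: "0 \<le> t"
  shows "{\<omega> \<in> space P. ereal t < first_gap l (N \<omega>)} \<in> events"
proof -
  define R where "R \<omega> \<longleftrightarrow> N \<omega> \<inter> {0<..<l} \<noteq> {} \<and>
    (\<exists>n::nat. \<forall>j::nat. N \<omega> \<inter> (cell (1 / real (Suc n)) j \<inter> {..t}) \<noteq> {} \<longrightarrow>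
       N \<omega> \<inter> {real (Suc j) * (1 / real (Suc n))<..<real j * (1 / real (Suc n)) + l} \<noteq> {})" for \<omega>
  have "{\<omega> \<in> space P. ereal t < first_gap l (N \<omega>)} = {\<omega> \<in> space P. R \<omega>}"
  proof (rule Collect_cong, rule conj_cong[OF refl])
    fix \<omega> assume \<omega>: "\<omega> \<in> space P"
    show "ereal t < first_gap l (N \<omega>) \<longleftrightarrow> R \<omega>"
      unfolding first_gap_greater_iff[OF realisation_pos[OF \<omega>] realisation_finite[OF \<omega>]]
        covered_iff_grid[OF realisation_pos[OF \<omega>] realisation_finite[OF \<omega>] t] R_def Let_def
      by (rule refl)
  qed
  moreover have [measurable]:
      "Measurable.pred P (\<lambda>\<omega>. N \<omega> \<inter> {a<..<b} \<noteq> {})"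
      "Measurable.pred P (\<lambda>\<omega>. N \<omega> \<inter> (cell h j \<inter> {..t}) \<noteq> {})" for a b h j
    by (rule hit_measurable; auto intro: bounded_subset[OF cell_bounded])+
  have "Measurable.pred P R"
    unfolding R_def by measurable
  ultimately show ?thesis
    by simp
qed

text \<open>The trials are started at a cell \<open>J\<close> beyond \<open>T\<close>; what happens before is ignored.\<close>

lemma prob_first_gap_le:
  assumes l: "0 < l" and \<gamma>: "0 \<le> \<gamma>" and m: "0 < m"
    and gap: "gap_integral \<gamma> m l < 1"
    and rate: "\<And>a b. T \<le> a \<Longrightarrow> 0 \<le> a \<Longrightarrow> a \<le> b \<Longrightarrow> measure \<Lambda> {a<..b} \<le> m * (b - a)"
  shows "\<exists>C>0. \<forall>t\<ge>0. prob {\<omega> \<in> space P. ereal t < first_gap l (N \<omega>)} \<le> C * exp (- \<gamma> * t)"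
proof -
  obtain K where K: "0 < K" "exp (\<gamma> * (l / real K)) * gap_integral \<gamma> m l \<le> 1"
    using gap_integral_fine_grid[OF gap] by blast
  define h where "h = l / real K"
  have h: "0 < h" "real K * h = l"
    using l K by (simp_all add: h_def)
  define p where "p = 1 - exp (- m * h)"
  define x where "x = exp (- \<gamma> * h)"
  have p: "0 < p" "p < 1" and x: "0 < x"
    using m h by (simp_all add: p_def x_def)
  have w: "run_weight K p x 0 \<le> 1"
    using run_weight_bounds(2)[OF m \<gamma> h(1), of K] K(2) h(2) by (simp add: p_def x_def h_def)
  define J where "J = nat \<lceil>T / h\<rceil>"
  have J: "T \<le> real J * h"
    using h real_nat_ceiling_ge[of "T / h"] by (simp add: J_def field_simps)
  define q where "q i = prob {\<omega> \<in> space P. hits N h i \<omega>}" for i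
  have q: "0 \<le> q i \<and> q i \<le> p" if "J \<le> i" for i
  proof -
    have "real J * h \<le> real i * h"
      using that h by simp
    with J have "T \<le> real i * h"
      by linarith
    then have "measure \<Lambda> (cell h i) \<le> m * (real (Suc i) * h - real i * h)"
      unfolding cell_def using h by (intro rate) auto
    then have "measure \<Lambda> (cell h i) \<le> m * h"
      by (simp add: algebra_simps)
    then show ?thesis
      by (simp add: q_def prob_hits p_def)
  qed
  define C where "C = exp (\<gamma> * (h + real J * h)) * (x / p)"
  have "prob {\<omega> \<in> space P. ereal t < first_gap l (N \<omega>)} \<le> C * exp (- \<gamma> * t)"
    if t: "0 \<le> t" for t
  proof -
    \<comment> \<open>every block of \<open>K \<ge> 1\<close> cells below \<open>J + n\<close> starts at or before \<open>t\<close>\<close>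
    define n where "n = nat \<lfloor>t / h\<rfloor> - J"
    have th: "0 \<le> \<lfloor>t / h\<rfloor>"
      using t h by simp
    have "no_long_run K (\<lambda>i. hits N h i \<omega>) 0 J n"
      if \<omega>: "\<omega> \<in> space P" and D: "ereal t < first_gap l (N \<omega>)" for \<omega>
      unfolding no_long_run_iff[OF K(1)]
    proof (intro allI impI)
      fix a assume a: "J \<le> a" "a + K \<le> J + n"
      have "a \<le> nat \<lfloor>t / h\<rfloor>"
        using a K by (auto simp: n_def)
      then have "real a \<le> t / h"
        using th by linarith
      then have "real a * h \<le> t"
        using h by (simp add: field_simps)
      from covered_imp_blocks_hit[OF realisation_finite[OF \<omega>] h _ this]
      have "\<exists>i\<in>{a..<a + K}. N \<omega> \<inter> cell h i \<noteq> {}"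
        using D first_gap_greater_iff[OF realisation_pos[OF \<omega>] realisation_finite[OF \<omega>]] by blast
      then show "\<exists>i\<in>{a..<a + K}. hits N h i \<omega>"
        using card_eq_0_iff_disjoint[OF \<omega>] by (simp add: hits_def del: card_eq_0_iff card_0_eq)
    qed
    then have "prob {\<omega> \<in> space P. ereal t < first_gap l (N \<omega>)} \<le>
        prob {\<omega> \<in> space P. no_long_run K (\<lambda>i. hits N h i \<omega>) 0 J n}"
      using h by (intro finite_measure_mono prob_no_long_run(1) indep_hits) auto
    also have "\<dots> = run_prob K q 0 J n"
      using h by (subst prob_no_long_run(2)) (auto intro!: indep_hits simp: q_def[abs_def])
    also have "\<dots> \<le> x ^ n * run_weight K p x 0 * (x / p)"
      using q K by (intro run_prob_le p x w) auto
    also have "\<dots> \<le> exp (- \<gamma> * (t - h - real J * h)) * 1 * (x / p)"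
    proof -
      have "x ^ n = exp (- \<gamma> * (h * real n))"
        by (simp add: x_def algebra_simps flip: exp_of_nat_mult)
      have "t / h - 1 - real J \<le> real n"
        using th by (simp add: n_def) linarith
      then have "t - h - real J * h \<le> h * real n"
        using h by (simp add: field_simps)
      then have "- \<gamma> * (h * real n) \<le> - \<gamma> * (t - h - real J * h)"
        using \<gamma> by (simp add: mult_left_mono)
      with \<open>x ^ n = _\<close> have "x ^ n \<le> exp (- \<gamma> * (t - h - real J * h))"
        by simp
      then show ?thesis
        using w x p run_weight_nonneg[OF p x] by (intro mult_mono) auto
    qed
    also have "\<dots> = C * exp (- \<gamma> * t)"
      by (simp add: C_def algebra_simps flip: exp_add)
    finally show ?thesis .
  qed
  moreover have "0 < C"
    using x p by (simp add: C_def)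
  ultimately show ?thesis
    by blast
qed

text \<open>The first \<open>J\<close> cells, which reach up to \<open>T\<close>, are all required to be occupied, at the cost of the constant
  \<open>\<Prod>i<J. q i\<close>, positive because the intensity charges every interval. The remaining trials are bounded
  by \<open>run_prob_ge\<close>.\<close>

lemma prob_first_gap_ge:
  assumes l: "0 < l" and \<gamma>: "0 \<le> \<gamma>" and m: "0 < m"
    and gap: "1 < gap_integral \<gamma> m l"
    and rate: "\<And>a b. T \<le> a \<Longrightarrow> 0 \<le> a \<Longrightarrow> a \<le> b \<Longrightarrow> m * (b - a) \<le> measure \<Lambda> {a<..b}"
    and pos: "\<And>a b. 0 \<le> a \<Longrightarrow> a < b \<Longrightarrow> 0 < measure \<Lambda> {a<..b}"
  shows "\<exists>c>0. \<forall>t\<ge>max 0 T. c * exp (- \<gamma> * t) \<le> prob {\<omega> \<in> space P. ereal t < first_gap l (N \<omega>)}"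
proof -
  obtain K where K: "0 < K" "1 < gap_integral \<gamma> m (real K * (l / real (Suc K)))"
    using gap_integral_shorten[OF gap l] by blast
  define h where "h = l / real (Suc K)"
  have h: "0 < h" "real (Suc K) * h = l"
    using l by (simp_all add: h_def del: of_nat_Suc)
  define p where "p = 1 - exp (- m * h)"
  define x where "x = exp (- \<gamma> * h)"
  have p: "0 < p" "p < 1" and x: "0 < x"
    using m h by (simp_all add: p_def x_def)
  have w: "1 \<le> run_weight K p x 0"
    using run_weight_bounds(1)[OF m \<gamma> h(1), of K] K(2) by (simp add: p_def x_def h_def)
  define J where "J = nat \<lceil>T / h\<rceil>"
  have J: "T \<le> real J * h"
    using h real_nat_ceiling_ge[of "T / h"] by (simp add: J_def field_simps)
  define q where "q i = prob {\<omega> \<in> space P. hits N h i \<omega>}" for i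
  have q01: "0 \<le> q i \<and> q i \<le> 1" for i
    by (simp add: q_def)
  have qpos: "0 < q i" for i
    using pos[of "real i * h" "real (Suc i) * h"] h by (simp add: q_def prob_hits cell_def)
  have q: "p \<le> q i \<and> q i \<le> 1" if "J \<le> i" for i
  proof -
    have "real J * h \<le> real i * h"
      using that h by simp
    with J have "T \<le> real i * h"
      by linarith
    then have "m * (real (Suc i) * h - real i * h) \<le> measure \<Lambda> (cell h i)"
      unfolding cell_def using h by (intro rate) auto
    then have "m * h \<le> measure \<Lambda> (cell h i)"
      by (simp add: algebra_simps)
    then show ?thesis
      by (simp add: q_def prob_hits p_def)
  qed
  define c where "c = (\<Prod>i\<in>{0..<0 + J}. q i) * exp (- \<gamma> * (l + h))"
  have "c * exp (- \<gamma> * t) \<le> prob {\<omega> \<in> space P. ereal t < first_gap l (N \<omega>)}"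
    if t: "max 0 T \<le> t" for t
  proof -
    \<comment> \<open>the cells must reach \<open>t + l\<close>, where the block after a point at \<open>t\<close> may end\<close>
    define M where "M = nat \<lceil>(t + l) / h\<rceil>"
    have M: "t + l \<le> real M * h"
      using h real_nat_ceiling_ge[of "(t + l) / h"] by (simp add: M_def field_simps)
    have "real M \<le> (t + l) / h + 1"
      using t l h by (simp add: M_def)
    then have M': "h * real M \<le> t + (l + h)"
      using h by (simp add: field_simps)
    have "J \<le> M"
      unfolding J_def M_def using t l h by (intro nat_mono ceiling_mono divide_right_mono) auto
    have "c * exp (- \<gamma> * t) = (\<Prod>i\<in>{0..<0 + J}. q i) * exp (- \<gamma> * (t + (l + h)))"
      by (simp add: c_def algebra_simps flip: exp_add)
    also have "\<dots> \<le> (\<Prod>i\<in>{0..<0 + J}. q i) * x ^ (M - J)"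
    proof (rule mult_left_mono)
      have "exp (- \<gamma> * (t + (l + h))) \<le> exp (- \<gamma> * (h * real M))"
        using M' \<gamma> by (simp add: mult_left_mono)
      also have "\<dots> = x ^ M"
        by (simp add: x_def algebra_simps flip: exp_of_nat_mult)
      also have "\<dots> \<le> x ^ (M - J)"
        using \<gamma> h by (intro power_decreasing) (auto simp: x_def)
      finally show "exp (- \<gamma> * (t + (l + h))) \<le> x ^ (M - J)" .
    qed (use q01 in \<open>auto intro: prod_nonneg\<close>)
    also have "x ^ (M - J) = x ^ (M - J) * run_weight K p x 0 / run_weight K p x 0"
      using w by simp
    also have "(\<Prod>i\<in>{0..<0 + J}. q i) * \<dots> \<le> (\<Prod>i\<in>{0..<0 + J}. q i) * run_prob K q 0 (0 + J) (M - J)"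
      using q q01 by (intro mult_left_mono run_prob_ge p x w prod_nonneg) auto
    also have "\<dots> \<le> run_prob K q 0 0 (J + (M - J))"
      using q01 K by (intro run_prob_ge_prod) auto
    also have "\<dots> = run_prob K q 0 0 M"
      using \<open>J \<le> M\<close> by simp
    also have "\<dots> = prob {\<omega> \<in> space P. no_long_run K (\<lambda>i. hits N h i \<omega>) 0 0 M}"
      using h by (subst prob_no_long_run(2)) (auto intro!: indep_hits simp: q_def[abs_def])
    also have "\<dots> \<le> prob {\<omega> \<in> space P. ereal t < first_gap l (N \<omega>)}"
    proof (rule finite_measure_mono)
      have "ereal t < first_gap l (N \<omega>)"
        if \<omega>: "\<omega> \<in> space P" and X: "no_long_run K (\<lambda>i. hits N h i \<omega>) 0 0 M" for \<omega>
      proof -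
        have "covered l (N \<omega>) t"
        proof (rule blocks_hit_imp_covered[OF realisation_pos[OF \<omega>] h M])
          fix a assume "a + K \<le> M"
          then have "\<exists>i\<in>{a..<a + K}. hits N h i \<omega>"
            using X unfolding no_long_run_iff[OF K(1)] by simp
          then show "\<exists>i\<in>{a..<a + K}. N \<omega> \<inter> cell h i \<noteq> {}"
            unfolding hits_def by (metis card.empty)
        qed (use t in simp)
        then show ?thesis
          using first_gap_greater_iff[OF realisation_pos[OF \<omega>] realisation_finite[OF \<omega>]] by blast
      qed
      then show "{\<omega> \<in> space P. no_long_run K (\<lambda>i. hits N h i \<omega>) 0 0 M} \<subseteq>
          {\<omega> \<in> space P. ereal t < first_gap l (N \<omega>)}"
        by blast
      show "{\<omega> \<in> space P. ereal t < first_gap l (N \<omega>)} \<in> events"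
        using t by (intro first_gap_measurable) simp
    qed
    finally show ?thesis .
  qed
  moreover have "0 < c"
    unfolding c_def using qpos by (intro mult_pos_pos prod_pos) auto
  ultimately show ?thesis
    by blast
qed

end

section \<open>The decay rate of the first gap\<close>

context
  fixes l :: real and \<mu> :: "real \<Rightarrow> real"
    and P :: "'a measure" and N :: "'a \<Rightarrow> real set"
  assumes l: "0 < l"
    and \<mu>: "\<mu> \<in> borel_measurable borel"
    and finite_rate: "\<And>t. cumulative_rate \<mu> 0 t < \<infinity>"
    and ppp: "poisson_point_process P N (intensity \<mu>)"
begin

abbreviation tail :: "real \<Rightarrow> real" where
  "tail t \<equiv> measure P {\<omega> \<in> space P. ereal t < first_gap l (N \<omega>)}"

lemma tail_le_1: "tail t \<le> 1"
  using ppp by (auto simp: poisson_point_process_def intro: prob_space.prob_le_1)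

lemma tail_exponential_upper_bound:
  assumes \<gamma>: "0 \<le> \<gamma>" and m: "0 < m" and gap: "gap_integral \<gamma> m l < 1"
    and ev: "eventually (\<lambda>t. \<mu> t \<le> m) at_top"
  shows "\<exists>C>0. eventually (\<lambda>t. tail t \<le> C * exp (- \<gamma> * t)) at_top"
proof -
  obtain T where T: "\<And>t. T \<le> t \<Longrightarrow> \<mu> t \<le> m"
    using ev by (auto simp: eventually_at_top_linorder)
  have "measure (intensity \<mu>) {a<..b} \<le> m * (b - a)" if "T \<le> a" "0 \<le> a" "a \<le> b" for a b
    using that m T by (intro measure_intensity_le[OF \<mu>]) auto
  from prob_first_gap_le[OF ppp l \<gamma> m gap this] show ?thesis
    unfolding eventually_at_top_linorder by blast
qed

lemma tail_exponential_lower_bound: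
  assumes \<gamma>: "0 \<le> \<gamma>" and m: "0 < m" and gap: "1 < gap_integral \<gamma> m l"
    and ev: "eventually (\<lambda>t. m \<le> \<mu> t) at_top"
    and pos: "AE t in lborel. t \<ge> 0 \<longrightarrow> \<mu> t > 0"
  shows "\<exists>c>0. eventually (\<lambda>t. c * exp (- \<gamma> * t) \<le> tail t) at_top"
proof -
  obtain T where T: "\<And>t. T \<le> t \<Longrightarrow> m \<le> \<mu> t"
    using ev by (auto simp: eventually_at_top_linorder)
  have "m * (b - a) \<le> measure (intensity \<mu>) {a<..b}" if "T \<le> a" "0 \<le> a" "a \<le> b" for a b
    using that m T by (intro measure_intensity_ge[OF \<mu> _ _ _ finite_rate]) auto
  from prob_first_gap_ge[OF ppp l \<gamma> m gap this measure_intensity_pos[OF \<mu> _ _ finite_rate pos]]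
  show ?thesis
    unfolding eventually_at_top_linorder by blast
qed

text \<open>The strict inequality at the limit rate \<open>m\<close> persists for some \<open>m' > m\<close>, which eventually bounds the
  rate function.\<close>

lemma decay_rate_eventually_gt:
  assumes "0 < m" "(\<mu> \<longlongrightarrow> m) at_top" "gap_integral \<gamma> m l < 1" "0 \<le> \<gamma>" "a < \<gamma>"
  shows "eventually (\<lambda>t. ereal a < - elog (tail t) / ereal t) at_top"
proof -
  have "((\<lambda>m'. m' / m * gap_integral \<gamma> m l) \<longlongrightarrow> m / m * gap_integral \<gamma> m l) (at_right m)"
    using assms by (intro tendsto_intros) auto
  then have "eventually (\<lambda>m'. m' / m * gap_integral \<gamma> m l < 1) (at_right m)"
    using assms by (intro order_tendstoD) auto
  then have "eventually (\<lambda>m'. m' / m * gap_integral \<gamma> m l < 1 \<and> m < m') (at_right m)"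
    using eventually_at_right_less[of m] by eventually_elim simp
  then obtain m' where m': "m < m'" "m' / m * gap_integral \<gamma> m l < 1"
    using eventually_happens'[OF trivial_limit_at_right_real] by blast
  have "gap_integral \<gamma> m' l < 1"
    using gap_integral_rate_le[of m m' \<gamma> l] m' assms by linarith
  moreover have "eventually (\<lambda>t. \<mu> t \<le> m') at_top"
    using order_tendstoD(2)[OF assms(2) m'(1)] by eventually_elim simp
  ultimately obtain C where "0 < C" "eventually (\<lambda>t. tail t \<le> C * exp (- \<gamma> * t)) at_top"
    using tail_exponential_upper_bound[of \<gamma> m'] assms m' by auto
  then show ?thesis
    using assms by (intro log_decay_rate_gt)
qed

lemma decay_rate_eventually_lt:
  assumes "0 < m" "(\<mu> \<longlongrightarrow> m) at_top" "1 < gap_integral \<gamma> m l" "0 \<le> \<gamma>" "\<gamma> < a"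
    and pos: "AE t in lborel. t \<ge> 0 \<longrightarrow> \<mu> t > 0"
  shows "eventually (\<lambda>t. - elog (tail t) / ereal t < ereal a) at_top"
proof -
  have "((\<lambda>m'. m' / m * gap_integral \<gamma> m l) \<longlongrightarrow> m / m * gap_integral \<gamma> m l) (at_left m)"
    using assms by (intro tendsto_intros) auto
  then have "eventually (\<lambda>m'. 1 < m' / m * gap_integral \<gamma> m l) (at_left m)"
    using assms by (intro order_tendstoD) auto
  then have "eventually (\<lambda>m'. 1 < m' / m * gap_integral \<gamma> m l \<and> 0 < m' \<and> m' < m) (at_left m)"
    using eventually_at_left_real[OF assms(1)] by eventually_elim simp
  then obtain m' where m': "0 < m'" "m' < m" "1 < m' / m * gap_integral \<gamma> m l"
    using eventually_happens'[OF trivial_limit_at_left_real] by blast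
  have "m' / m * gap_integral \<gamma> m l \<le> m' / m * (m / m' * gap_integral \<gamma> m' l)"
    using gap_integral_rate_le[of m' m \<gamma> l] m' by (intro mult_left_mono) auto
  also have "\<dots> = gap_integral \<gamma> m' l"
    using m' by simp
  finally have "1 < gap_integral \<gamma> m' l"
    using m'(3) by linarith
  moreover have "eventually (\<lambda>t. m' \<le> \<mu> t) at_top"
    using order_tendstoD(1)[OF assms(2) m'(2)] by eventually_elim simp
  ultimately obtain c where "0 < c" "eventually (\<lambda>t. c * exp (- \<gamma> * t) \<le> tail t) at_top"
    using tail_exponential_lower_bound[of \<gamma> m'] assms m' by auto
  then show ?thesis
    using assms by (intro log_decay_rate_lt)
qed

lemma decay_rate_nonneg: "eventually (\<lambda>t. 0 \<le> - elog (tail t) / ereal t) at_top"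
  using eventually_gt_at_top[of 0]
proof eventually_elim
  case (elim t)
  have "elog (tail t) \<le> 0"
    using elog_mono[OF tail_le_1[of t]] by (simp add: elog_def[of 1] zero_ereal_def)
  then show ?case
    using elim by (intro zero_le_divide_ereal) (auto simp: ereal_uminus_le_reorder)
qed

lemma decay_rate_tendsto:
  assumes m: "0 < m" "(\<mu> \<longlongrightarrow> m) at_top" and \<gamma>: "0 < \<gamma>" "gap_integral \<gamma> m l = 1"
    and pos: "AE t in lborel. t \<ge> 0 \<longrightarrow> \<mu> t > 0"
  shows "((\<lambda>t. - elog (tail t) / ereal t) \<longlongrightarrow> ereal \<gamma>) at_top"
proof (rule order_tendstoI)
  fix a assume "a < ereal \<gamma>"
  then obtain b where b: "a < ereal b" "b < \<gamma>"
    using ereal_dense2[of a "ereal \<gamma>"] by auto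
  define g where "g = max 0 ((b + \<gamma>) / 2)"
  have "b < g" "0 \<le> g" "g < \<gamma>"
    using b \<gamma> by (auto simp: g_def max_def)
  moreover have "gap_integral g m l < 1"
    using gap_integral_strict_mono[OF m(1) l \<open>g < \<gamma>\<close>] \<gamma> by simp
  ultimately have "eventually (\<lambda>t. ereal b < - elog (tail t) / ereal t) at_top"
    using m by (intro decay_rate_eventually_gt)
  then show "eventually (\<lambda>t. a < - elog (tail t) / ereal t) at_top"
    by eventually_elim (use b in \<open>auto intro: less_trans\<close>)
next
  fix a assume "ereal \<gamma> < a"
  then obtain b where b: "ereal b < a" "\<gamma> < b"
    using ereal_dense2[of "ereal \<gamma>" a] by auto
  define g where "g = (b + \<gamma>) / 2"
  have "g < b" "0 \<le> g" "\<gamma> < g"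
    using b \<gamma> by (auto simp: g_def)
  moreover have "1 < gap_integral g m l"
    using gap_integral_strict_mono[OF m(1) l \<open>\<gamma> < g\<close>] \<gamma> by simp
  ultimately have "eventually (\<lambda>t. - elog (tail t) / ereal t < ereal b) at_top"
    using m pos by (intro decay_rate_eventually_lt)
  then show "eventually (\<lambda>t. - elog (tail t) / ereal t < a) at_top"
    by eventually_elim (use b in \<open>auto intro: less_trans\<close>)
qed

lemma decay_rate_tendsto_0:
  assumes "filterlim \<mu> at_top at_top" and pos: "AE t in lborel. t \<ge> 0 \<longrightarrow> \<mu> t > 0"
  shows "((\<lambda>t. - elog (tail t) / ereal t) \<longlongrightarrow> 0) at_top"
proof (rule order_tendstoI)
  fix a :: ereal assume a: "a < 0"
  show "eventually (\<lambda>t. a < - elog (tail t) / ereal t) at_top"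
    using decay_rate_nonneg by eventually_elim (rule less_le_trans[OF a])
next
  fix a :: ereal assume "0 < a"
  then obtain b where b: "ereal b < a" "0 < b"
    using ereal_dense2[of 0 a] by (auto simp: zero_ereal_def)
  obtain m where m: "0 < m" "1 < gap_integral (b / 2) m l"
    using gap_integral_large_rate[of "b / 2" l] b l by auto
  have "eventually (\<lambda>t. m \<le> \<mu> t) at_top"
    using assms(1) by (simp add: filterlim_at_top)
  then obtain c where c: "0 < c" "eventually (\<lambda>t. c * exp (- (b / 2) * t) \<le> tail t) at_top"
    using tail_exponential_lower_bound[of "b / 2" m] m b pos by auto
  have "eventually (\<lambda>t. - elog (tail t) / ereal t < ereal b) at_top"
    using b by (intro log_decay_rate_lt[OF c]) simp
  then show "eventually (\<lambda>t. - elog (tail t) / ereal t < a) at_top"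
    by eventually_elim (use b in \<open>auto intro: less_trans\<close>)
qed

lemma decay_rate_tendsto_infinity:
  assumes "(\<mu> \<longlongrightarrow> 0) at_top"
  shows "((\<lambda>t. - elog (tail t) / ereal t) \<longlongrightarrow> \<infinity>) at_top"
  unfolding tendsto_PInfty
proof
  fix r :: real
  define g where "g = \<bar>r\<bar> + 1"
  have g: "r < g" "0 \<le> g"
    by (auto simp: g_def)
  obtain m where m: "0 < m" "gap_integral g m l < 1"
    using gap_integral_small_rate[OF l g(2)] by blast
  have "eventually (\<lambda>t. \<mu> t \<le> m) at_top"
    using order_tendstoD(2)[OF assms m(1)] by eventually_elim simp
  then obtain C where "0 < C" "eventually (\<lambda>t. tail t \<le> C * exp (- g * t)) at_top"
    using tail_exponential_upper_bound[of g m] m g by auto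
  then show "eventually (\<lambda>t. ereal r < - elog (tail t) / ereal t) at_top"
    using g by (intro log_decay_rate_gt)
qed

end

theorem corollary5p1:
  fixes l :: real and \<mu> :: "real \<Rightarrow> real"
    and P :: "'a measure" and N :: "'a \<Rightarrow> real set" and D :: "'a \<Rightarrow> ereal"
  assumes "l > 0"
    and "\<mu> \<in> borel_measurable borel"
    and "\<And>t. t \<ge> 0 \<Longrightarrow> \<mu> t \<ge> 0"
    and "AE t in lborel. t \<ge> 0 \<longrightarrow> \<mu> t > 0"
    and "\<And>t. cumulative_rate \<mu> 0 t < \<infinity>"
    and "poisson_point_process P N (intensity \<mu>)"
    and "\<And>\<omega>. D \<omega> = first_gap l (N \<omega>)"
  shows "(\<forall>m>0. (\<mu> \<longlongrightarrow> m) at_top \<longrightarrow>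
            (\<exists>\<gamma>>0. 1 = integral {0..l} (\<lambda>s. m * exp ((\<gamma> - m) * s)) \<and>
               (\<forall>\<gamma>'. 1 = integral {0..l} (\<lambda>s. m * exp ((\<gamma>' - m) * s)) \<longrightarrow> \<gamma>' = \<gamma>) \<and>
               (\<lambda>t. measure P {\<omega>\<in>space P. D \<omega> > ereal t}) \<approx>log (\<lambda>t. exp (- \<gamma> * t)))) \<and>
         (filterlim \<mu> at_top at_top \<longrightarrow>
            ((\<lambda>t. - elog (measure P {\<omega>\<in>space P. D \<omega> > ereal t}) / ereal t) \<longlongrightarrow> 0) at_top) \<and>
         ((\<mu> \<longlongrightarrow> 0) at_top \<longrightarrow>
            ((\<lambda>t. - elog (measure P {\<omega>\<in>space P. D \<omega> > ereal t}) / ereal t) \<longlongrightarrow> \<infinity>) at_top)"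
proof -
  have D: "{\<omega> \<in> space P. ereal t < D \<omega>} = {\<omega> \<in> space P. ereal t < first_gap l (N \<omega>)}" for t
    using assms(7) by simp
  note process = assms(1,2,5,6)
  show ?thesis
    unfolding D
  proof (intro conjI allI impI)
    fix m :: real assume m: "0 < m" "(\<mu> \<longlongrightarrow> m) at_top"
    obtain \<gamma> where \<gamma>: "0 < \<gamma>" "gap_integral \<gamma> m l = 1"
      using gap_integral_root[OF m(1) assms(1)] by blast
    have unique: "\<gamma>' = \<gamma>" if "gap_integral \<gamma>' m l = 1" for \<gamma>'
      using that \<gamma>(2) gap_integral_strict_mono[OF m(1) assms(1), of \<gamma> \<gamma>']
        gap_integral_strict_mono[OF m(1) assms(1), of \<gamma>' \<gamma>] by linarith
    have "(\<lambda>t. measure P {\<omega> \<in> space P. ereal t < first_gap l (N \<omega>)}) \<approx>log (\<lambda>t. exp (- \<gamma> * t))"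
      by (intro approx_log_exp \<gamma> decay_rate_tendsto[OF process m \<gamma> assms(4)])
    with \<gamma>(1) \<gamma>(2)[symmetric] unique[OF sym]
    show "\<exists>\<gamma>>0. 1 = integral {0..l} (\<lambda>s. m * exp ((\<gamma> - m) * s)) \<and>
        (\<forall>\<gamma>'. 1 = integral {0..l} (\<lambda>s. m * exp ((\<gamma>' - m) * s)) \<longrightarrow> \<gamma>' = \<gamma>) \<and>
        (\<lambda>t. measure P {\<omega> \<in> space P. ereal t < first_gap l (N \<omega>)}) \<approx>log (\<lambda>t. exp (- \<gamma> * t))"
      unfolding gap_integral_def by (intro exI[of _ \<gamma>] conjI allI impI)
  next
    assume "filterlim \<mu> at_top at_top"
    then show "((\<lambda>t. - elog (measure P {\<omega> \<in> space P. ereal t < first_gap l (N \<omega>)}) / ereal t)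
        \<longlongrightarrow> 0) at_top"
      by (rule decay_rate_tendsto_0[OF process _ assms(4)])
  next
    assume "(\<mu> \<longlongrightarrow> 0) at_top"
    then show "((\<lambda>t. - elog (measure P {\<omega> \<in> space P. ereal t < first_gap l (N \<omega>)}) / ereal t)
        \<longlongrightarrow> \<infinity>) at_top"
      by (rule decay_rate_tendsto_infinity[OF process])
  qed
qed

end
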